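(* Let $\varepsilon>0$ be a constant and let $q\ge 1$ be a constant. There exists a one-pass dynamic streaming algorithm that, with constant success probability, estimates the number of connected components of a graph $G$ on vertex set $[n]$ within an additive error $\varepsilon n$, using $O(e^{q+1} n^{1-\varepsilon+\varepsilon^{q+1}}\cdot\mathrm{poly}\log n)$ space and post-processing time.
   Context: In the dynamic streaming model, the input graph on the fixed vertex set $[n]$ is defined by a sequence of edge insertions and deletions; the algorithm makes a single pass over the stream. Post-processing time is the time needed after the stream ends to produce the output. An estimate $Y$ of a quantity $X$ has additive error at most $\delta$ if $|Y-X|\le\delta$. *)

theory Defs
  imports "HOL-Probability.Probability" "HOL-Probability.SPMF" "HOL-Library.Log_Nat"
begin

section \<open>Dynamic graph streams\<close>

text \<open>Edges of a simple graph on \<open>{1..n}\<close> are two-element sets; an update presents an edge by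
  its endpoints, in either order.\<close>

datatype edge_update = Insert nat nat | Delete nat nat

fun apply_update :: "nat set set \<Rightarrow> edge_update \<Rightarrow> nat set set" where
  "apply_update E (Insert u v) = E \<union> {{u, v}}"
| "apply_update E (Delete u v) = E - {{u, v}}"

definition stream_graph :: "edge_update list \<Rightarrow> nat set set" where
  "stream_graph xs = foldl apply_update {} xs"

text \<open>Only absent edges are inserted and only present edges are deleted.\<close>

fun legal_update :: "nat \<Rightarrow> nat set set \<Rightarrow> edge_update \<Rightarrow> bool" where
  "legal_update n E (Insert u v) \<longleftrightarrow> u \<in> {1..n} \<and> v \<in> {1..n} \<and> u \<noteq> v \<and> {u, v} \<notin> E"
| "legal_update n E (Delete u v) \<longleftrightarrow> {u, v} \<in> E"

definition dynamic_stream :: "nat \<Rightarrow> edge_update list \<Rightarrow> bool" where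
  "dynamic_stream n xs \<longleftrightarrow>
     (\<forall>i < length xs. legal_update n (stream_graph (take i xs)) (xs ! i))"

definition num_components :: "nat \<Rightarrow> nat set set \<Rightarrow> nat" where
  "num_components n E =
     card ({1..n} // {(u, v). u \<in> {1..n} \<and> v \<in> {1..n} \<and> (u, v) \<in> {(x, y). {x, y} \<in> E}\<^sup>*})"


section \<open>A randomised word RAM\<close>

text \<open>The memory is a list of words, that is, of numbers below \<open>2 ^ w\<close> where \<open>w\<close> is the word size.
  An operand \<open>i\<close> of an instruction is the address of a cell. There are no other registers, and coin
  flips can be used again only if they are stored. Missing probability mass stands for
  an access outside the memory or for divergence.\<close>

datatype binop = Add | Sub | Mul | Div | Mod | Less | Eq

fun binop_word :: "nat \<Rightarrow> binop \<Rightarrow> nat \<Rightarrow> nat \<Rightarrow> nat" where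
  "binop_word w Add a b = (a + b) mod 2 ^ w"
| "binop_word w Sub a b = (a + 2 ^ w - b) mod 2 ^ w"
| "binop_word w Mul a b = (a * b) mod 2 ^ w"
| "binop_word w Div a b = a div b"
| "binop_word w Mod a b = a mod b"
| "binop_word w Less a b = of_bool (a < b) mod 2 ^ w"
| "binop_word w Eq a b = of_bool (a = b) mod 2 ^ w"

datatype instr =
    Const nat nat           \<comment> \<open>\<open>m[i] := k\<close>\<close>
  | Op binop nat nat nat    \<comment> \<open>\<open>m[i] := m[j] op m[k]\<close>\<close>
  | Load nat nat            \<comment> \<open>\<open>m[i] := m[m[j]]\<close>\<close>
  | Store nat nat           \<comment> \<open>\<open>m[m[i]] := m[j]\<close>\<close>
  | Flip nat                \<comment> \<open>\<open>m[i] :=\<close> a fresh uniformly random bit\<close>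

definition read_cell :: "nat list \<Rightarrow> nat \<Rightarrow> nat spmf" where
  "read_cell m i = (if i < length m then return_spmf (m ! i) else return_pmf None)"

definition write_cell :: "nat list \<Rightarrow> nat \<Rightarrow> nat \<Rightarrow> nat list spmf" where
  "write_cell m i x = (if i < length m then return_spmf (m[i := x]) else return_pmf None)"

fun exec_instr :: "nat \<Rightarrow> instr \<Rightarrow> nat list \<Rightarrow> nat list spmf" where
  "exec_instr w (Const i k) m = write_cell m i (k mod 2 ^ w)"
| "exec_instr w (Op f i j k) m =
     bind_spmf (read_cell m j) (\<lambda>a. bind_spmf (read_cell m k) (\<lambda>b.
       write_cell m i (binop_word w f a b)))"
| "exec_instr w (Load i j) m =
     bind_spmf (read_cell m j) (\<lambda>a. bind_spmf (read_cell m a) (\<lambda>x. write_cell m i x))"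
| "exec_instr w (Store i j) m =
     bind_spmf (read_cell m i) (\<lambda>a. bind_spmf (read_cell m j) (\<lambda>x. write_cell m a x))"
| "exec_instr w (Flip i) m =
     bind_spmf coin_spmf (\<lambda>b. write_cell m i (of_bool b mod 2 ^ w))"

datatype prog =
    Skip
  | Do instr
  | Seq prog prog
  | Cond nat prog prog    \<comment> \<open>branches on \<open>m[i] \<noteq> 0\<close>\<close>
  | While nat prog        \<comment> \<open>repeats while \<open>m[i] \<noteq> 0\<close>\<close>

text \<open>The result is the final memory together with the number of steps; every instruction and every
  evaluation of a branch or loop condition is one step.\<close>

partial_function (spmf) exec :: "nat \<Rightarrow> prog \<Rightarrow> nat list \<Rightarrow> (nat list \<times> nat) spmf" where
  "exec w p m =
     (case p of
        Skip \<Rightarrow> return_spmf (m, 0)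
      | Do a \<Rightarrow> map_spmf (\<lambda>m'. (m', 1)) (exec_instr w a m)
      | Seq p1 p2 \<Rightarrow>
          bind_spmf (exec w p1 m) (\<lambda>(m1, t1).
          bind_spmf (exec w p2 m1) (\<lambda>(m2, t2). return_spmf (m2, t1 + t2)))
      | Cond i p1 p2 \<Rightarrow>
          bind_spmf (read_cell m i) (\<lambda>x.
          bind_spmf (exec w (if x \<noteq> 0 then p1 else p2) m) (\<lambda>(m1, t1). return_spmf (m1, 1 + t1)))
      | While i p1 \<Rightarrow>
          bind_spmf (read_cell m i) (\<lambda>x.
          if x = 0 then return_spmf (m, 1)
          else
            bind_spmf (exec w p1 m) (\<lambda>(m1, t1).
            bind_spmf (exec w p m1) (\<lambda>(m2, t2). return_spmf (m2, 1 + t1 + t2)))))"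


section \<open>One-pass streaming algorithms\<close>

text \<open>The three programs do not depend on \<open>n\<close>. Words have \<open>\<Theta>(log n)\<close> bits, and
  \<open>cells n\<close> is the number of words of memory the algorithm is given on \<open>n\<close> vertices, from the
  initialisation to the output; nothing else persists between updates.\<close>

record streaming_alg =
  word_factor :: nat
  cells :: "nat \<Rightarrow> nat"
  init_prog :: prog
  update_prog :: prog
  post_prog :: prog

text \<open>The cells \<open>0\<close>, \<open>1\<close>, \<open>2\<close> serve for input and output.\<close>

definition wf_alg :: "streaming_alg \<Rightarrow> bool" where
  "wf_alg A \<longleftrightarrow> 1 \<le> word_factor A \<and> (\<forall>n. 3 \<le> cells A n)"

definition word_size :: "streaming_alg \<Rightarrow> nat \<Rightarrow> nat" where
  "word_size A n = word_factor A * floorlog 2 n"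

definition space_bits :: "streaming_alg \<Rightarrow> nat \<Rightarrow> nat" where
  "space_bits A n = cells A n * word_size A n"

fun feed :: "edge_update \<Rightarrow> nat list \<Rightarrow> nat list" where
  "feed (Insert u v) m = m[0 := 1, 1 := u, 2 := v]"
| "feed (Delete u v) m = m[0 := 0, 1 := u, 2 := v]"

fun run_updates :: "streaming_alg \<Rightarrow> nat \<Rightarrow> edge_update list \<Rightarrow> nat list \<Rightarrow> nat list spmf" where
  "run_updates A n [] m = return_spmf m"
| "run_updates A n (x # xs) m =
     bind_spmf (exec (word_size A n) (update_prog A) (feed x m)) (\<lambda>(m', _). run_updates A n xs m')"

text \<open>The joint distribution of the estimate and the number of post-processing steps.\<close>

definition run_alg :: "streaming_alg \<Rightarrow> nat \<Rightarrow> edge_update list \<Rightarrow> (nat \<times> nat) spmf" where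
  "run_alg A n xs =
     bind_spmf (exec (word_size A n) (init_prog A) ((replicate (cells A n) 0)[0 := n])) (\<lambda>(m0, _).
     bind_spmf (run_updates A n xs m0) (\<lambda>m1.
     bind_spmf (exec (word_size A n) (post_prog A) m1) (\<lambda>(m2, t). return_spmf (m2 ! 0, t))))"

definition estimates_components :: "streaming_alg \<Rightarrow> (nat \<Rightarrow> real) \<Rightarrow> real \<Rightarrow> bool" where
  "estimates_components A \<delta> \<rho> \<longleftrightarrow>
     (\<forall>n\<ge>1. \<forall>xs. dynamic_stream n xs \<longrightarrow>
        measure (measure_spmf (run_alg A n xs))
          {(Y, t). \<bar>real Y - real (num_components n (stream_graph xs))\<bar> \<le> \<delta> n} \<ge> \<rho>)"

text \<open>The bound holds for every outcome of the coin flips; losslessness excludes runs that fail or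
  diverge.\<close>

definition post_time_le :: "streaming_alg \<Rightarrow> nat \<Rightarrow> real \<Rightarrow> bool" where
  "post_time_le A n T \<longleftrightarrow>
     (\<forall>xs. dynamic_stream n xs \<longrightarrow>
        lossless_spmf (run_alg A n xs) \<and> (\<forall>(Y, t) \<in> set_spmf (run_alg A n xs). real t \<le> T))"

end

theory Submission
  imports Defs
begin

text \<open>For \<open>\<epsilon> < 1\<close> put \<open>t = \<lfloor>1 / \<epsilon>\<rfloor>\<close>. Fewer than \<open>\<epsilon> * n\<close> components have more than \<open>t\<close> vertices, so
  it suffices to estimate the number of the others, within an error \<open>\<delta> * n\<close> where
  \<open>\<delta> = \<epsilon> - 1 / (t + 1) > 0\<close>. Sample every vertex independently with probability \<open>1 / P\<close>, where
  \<open>P ^ t\<close> is about \<open>n\<close> up to a constant factor, and count every component \<open>C\<close> of size at most \<open>t\<close>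
  that is sampled completely with weight \<open>P ^ card C\<close>. This is unbiased with variance at most
  \<open>n * P ^ t\<close>, so Chebyshev's inequality applies, and about
  \<open>n / P = O(n powr (1 - 1 / t)) \<le> O(n powr (1 - \<epsilon>))\<close> vertices are sampled.

  To recognise the components among the subsets of the sample, keep for every sampled vertex \<open>u\<close> the
  power sums of order at most \<open>2 * t\<close> of its neighbours, which are maintained under insertions and
  deletions. No edge leaves a set \<open>T\<close> of at most \<open>t\<close> sampled vertices iff the sum of
  \<open>\<Prod>y\<in>T. (v - y)\<^sup>2\<close> over all neighbours \<open>v\<close> of elements of \<open>T\<close> vanishes, and this sum is
  a linear combination of the power sums. The time of an update is not restricted; hence the estimate
  is recomputed by exhaustive search after each update, and the post-processing is empty.\<close>

section \<open>Output distributions: step counts are dropped, the mass of failures is kept\<close>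

section \<open>Running programs without counting steps\<close>

text \<open>The choice of \<open>t\<close> serves two ends: \<open>\<epsilon> \<le> 1 / t\<close>
  gives the space bound, and \<open>1 / (t + 1) < \<epsilon>\<close> leaves a positive margin for
  the sampling error. A union of several components is closed too, so the search proceeds by
  increasing size and refuses tuples that meet a component already counted. Neighbours outside the
  sample enter the power sums as well; this is how an edge leaving the sample is noticed. The
  certificate has degree \<open>2 * t\<close>, whence the order of the power sums. It is computed in
  words: intermediate values may wrap, but the final integer is nonnegative and below
  \<open>2 ^ w\<close>, hence exact. Taking a power of two for \<open>P\<close> turns the sampling
  of a vertex into a conjunction of fair coins. The memory is fixed by \<open>n\<close> while the
  sample size is random; cutting the sample at about six times its mean makes every run safe, and
  the cut is active with probability at most \<open>1 / 6\<close>. One algorithm serves all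
  \<open>q\<close>, because \<open>n powr (1 - \<epsilon>) * ln n\<close> already lies within the
  claimed bound up to a constant. For \<open>\<epsilon> \<ge> 1\<close> every number up to
  \<open>n\<close> is an acceptable answer.\<close>

definition run :: "nat \<Rightarrow> prog \<Rightarrow> nat list \<Rightarrow> nat list spmf" where
  "run w p m = map_spmf fst (exec w p m)"

lemma run_Skip: "run w Skip m = return_spmf m"
  unfolding run_def by (subst exec.simps) simp

lemma run_Do: "run w (Do a) m = exec_instr w a m"
  unfolding run_def by (subst exec.simps) (simp add: spmf.map_comp o_def)

lemma run_Seq: "run w (Seq p1 p2) m = bind_spmf (run w p1 m) (run w p2)"
  unfolding run_def
  by (subst exec.simps)
     (simp add: map_spmf_bind_spmf bind_map_spmf o_def split_def map_spmf_conv_bind_spmf)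

lemma run_Cond:
  "run w (Cond i p1 p2) m = bind_spmf (read_cell m i) (\<lambda>x. run w (if x \<noteq> 0 then p1 else p2) m)"
  unfolding run_def
  by (subst exec.simps)
     (simp add: map_spmf_bind_spmf bind_map_spmf o_def split_def map_spmf_conv_bind_spmf)

lemma run_While:
  "run w (While i p) m = bind_spmf (read_cell m i) (\<lambda>x.
     if x = 0 then return_spmf m else bind_spmf (run w p m) (run w (While i p)))"
  unfolding run_def
  by (subst exec.simps)
     (simp add: map_spmf_bind_spmf bind_map_spmf o_def split_def map_spmf_conv_bind_spmf
        if_distrib[of "\<lambda>p. bind_spmf p _"] cong: if_cong)


section \<open>Compilation of structured commands to the word RAM\<close>

section \<open>A small imperative language\<close>

text \<open>Commands see the cells below \<open>16\<close>, which hold the variables, and the cells from \<open>b\<close> on, which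
  hold an array. The cells in between are the evaluation stack. The array base is a separate
  expression \<open>Base\<close>, so that the required stack size can be computed before \<open>b\<close> is fixed.\<close>

datatype exp = Num nat | Base | At exp | Bin binop exp exp

abbreviation Var :: "nat \<Rightarrow> exp" where "Var i \<equiv> At (Num i)"

datatype com =
    Nop
  | Put exp exp
  | Toss nat
  | Then com com
  | If exp com com
  | Loop exp com

abbreviation Asg :: "nat \<Rightarrow> exp \<Rightarrow> com" where "Asg i \<equiv> Put (Num i)"

text \<open>Evaluation at depth \<open>d\<close> occupies the cells from \<open>d\<close> up to
  \<open>d + stack_exp e - 1\<close>: in \<open>Bin\<close> the value of \<open>e1\<close> waits in
  cell \<open>d\<close> while \<open>e2\<close> is evaluated from \<open>Suc d\<close> on.\<close>

fun stack_exp :: "exp \<Rightarrow> nat" where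
  "stack_exp (Num k) = 1"
| "stack_exp Base = 1"
| "stack_exp (At e) = stack_exp e"
| "stack_exp (Bin f e1 e2) = max (stack_exp e1) (Suc (stack_exp e2))"

lemma stack_exp_pos: "0 < stack_exp e"
  by (induction e) auto

fun stack_com :: "com \<Rightarrow> nat" where
  "stack_com Nop = 0"
| "stack_com (Put e1 e2) = max (stack_exp e1) (Suc (stack_exp e2))"
| "stack_com (Toss i) = 0"
| "stack_com (Then c1 c2) = max (stack_com c1) (stack_com c2)"
| "stack_com (If e c1 c2) = max (stack_exp e) (max (stack_com c1) (stack_com c2))"
| "stack_com (Loop e c) = max (stack_exp e) (stack_com c)"

fun compile_exp :: "nat \<Rightarrow> nat \<Rightarrow> exp \<Rightarrow> prog" where
  "compile_exp b d (Num k) = Do (Const d k)"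
| "compile_exp b d Base = Do (Const d b)"
| "compile_exp b d (At e) = Seq (compile_exp b d e) (Do (Load d d))"
| "compile_exp b d (Bin f e1 e2) =
     Seq (compile_exp b d e1) (Seq (compile_exp b (Suc d) e2) (Do (Op f d d (Suc d))))"

fun compile :: "nat \<Rightarrow> com \<Rightarrow> prog" where
  "compile b Nop = Skip"
| "compile b (Put e1 e2) = Seq (compile_exp b 16 e1) (Seq (compile_exp b 17 e2) (Do (Store 16 17)))"
| "compile b (Toss i) = Do (Flip i)"
| "compile b (Then c1 c2) = Seq (compile b c1) (compile b c2)"
| "compile b (If e c1 c2) = Seq (compile_exp b 16 e) (Cond 16 (compile b c1) (compile b c2))"
| "compile b (Loop e c) =
     Seq (compile_exp b 16 e) (While 16 (Seq (compile b c) (compile_exp b 16 e)))"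

text \<open>\<open>b\<close> is the base of the array and \<open>N\<close> the size of the memory;
  \<open>N \<le> 2 ^ w\<close> makes every address a word, so that address arithmetic can be
  exact.\<close>

locale ram =
  fixes w b N :: nat
  assumes b_ge: "16 \<le> b" and b_le: "b \<le> N" and N_le: "N \<le> 2 ^ w"
begin

lemma w_pos: "1 < (2::nat) ^ w"
  using b_ge b_le N_le by linarith

fun eval :: "(nat \<Rightarrow> nat) \<Rightarrow> exp \<Rightarrow> nat" where
  "eval \<sigma> (Num k) = k mod 2 ^ w"
| "eval \<sigma> Base = b mod 2 ^ w"
| "eval \<sigma> (At e) = \<sigma> (eval \<sigma> e)"
| "eval \<sigma> (Bin f e1 e2) = binop_word w f (eval \<sigma> e1) (eval \<sigma> e2)"

definition in_mem :: "nat \<Rightarrow> bool" where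
  "in_mem a \<longleftrightarrow> a < N \<and> (a < 16 \<or> b \<le> a)"

fun safe :: "(nat \<Rightarrow> nat) \<Rightarrow> exp \<Rightarrow> bool" where
  "safe \<sigma> (Num k) = True"
| "safe \<sigma> Base = True"
| "safe \<sigma> (At e) \<longleftrightarrow> safe \<sigma> e \<and> in_mem (eval \<sigma> e)"
| "safe \<sigma> (Bin f e1 e2) \<longleftrightarrow> safe \<sigma> e1 \<and> safe \<sigma> e2"

text \<open>A state is a total function, compared with the memory only on variables and array. The
  stack cells from \<open>16\<close> up to \<open>b - 1\<close> are invisible, so evaluating an
  expression does not change the state.\<close>

definition sim :: "(nat \<Rightarrow> nat) \<Rightarrow> nat list \<Rightarrow> bool" where
  "sim \<sigma> m \<longleftrightarrow> length m = N \<and> (\<forall>i. in_mem i \<longrightarrow> m ! i = \<sigma> i)"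

text \<open>All writes go to stack cells from \<open>d\<close> on, which \<open>sim\<close> ignores.
  Keeping the cells below \<open>d\<close> intact protects pending left operands.\<close>

lemma comp_exp_correct:
  assumes "safe \<sigma> e" "stack_exp e + d \<le> b" "16 \<le> d" "sim \<sigma> m"
  shows "\<exists>m'. run w (compile_exp b d e) m = return_spmf m' \<and> sim \<sigma> m' \<and> m' ! d = eval \<sigma> e \<and>
           (\<forall>i<d. m' ! i = m ! i)"
  using assms
proof (induction e arbitrary: d m)
  case (Num k)
  then show ?case using b_le
    by (auto simp: run_Do write_cell_def sim_def in_mem_def nth_list_update)
next
  case Base
  then show ?case using b_le
    by (auto simp: run_Do write_cell_def sim_def in_mem_def nth_list_update)
next
  case (At e)
  then obtain m' where m': "run w (compile_exp b d e) m = return_spmf m'" "sim \<sigma> m'"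
    "m' ! d = eval \<sigma> e" "\<forall>i<d. m' ! i = m ! i"
    by (metis safe.simps(3) stack_exp.simps(3))
  have "d < N" "d < b" using At.prems b_le stack_exp_pos[of e] by auto
  with m' At.prems show ?case
    by (auto simp: run_Seq run_Do read_cell_def write_cell_def sim_def in_mem_def nth_list_update)
next
  case (Bin f e1 e2)
  have "stack_exp e1 + d \<le> b" using Bin.prems by simp
  with Bin obtain m1 where m1: "run w (compile_exp b d e1) m = return_spmf m1" "sim \<sigma> m1"
    "m1 ! d = eval \<sigma> e1" "\<forall>i<d. m1 ! i = m ! i"
    by (metis safe.simps(4))
  have "\<exists>m2. run w (compile_exp b (Suc d) e2) m1 = return_spmf m2 \<and> sim \<sigma> m2 \<and>
      m2 ! Suc d = eval \<sigma> e2 \<and> (\<forall>i<Suc d. m2 ! i = m1 ! i)"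
    using Bin.prems m1 by (intro Bin.IH(2)) auto
  then obtain m2 where m2: "run w (compile_exp b (Suc d) e2) m1 = return_spmf m2" "sim \<sigma> m2"
    "m2 ! Suc d = eval \<sigma> e2" "\<forall>i<Suc d. m2 ! i = m1 ! i" by blast
  have "Suc d < N" "Suc d < b" using Bin.prems b_le stack_exp_pos[of e2] by auto
  with m1 m2 Bin.prems show ?case
    by (auto simp: run_Seq run_Do read_cell_def write_cell_def sim_def in_mem_def nth_list_update)
qed

section \<open>A calculus of total correctness by couplings\<close>

subsection \<open>Weakest preconditions\<close>

text \<open>The outcome of the command is coupled with a ghost variable of distribution \<open>D\<close>.\<close>

definition rwp :: "com \<Rightarrow> 'a pmf \<Rightarrow> ('a \<Rightarrow> (nat \<Rightarrow> nat) \<Rightarrow> bool) \<Rightarrow> (nat \<Rightarrow> nat) \<Rightarrow> bool" where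
  "rwp c D Q \<sigma> \<longleftrightarrow> (16 + stack_com c \<le> b \<longrightarrow> (\<forall>m. sim \<sigma> m \<longrightarrow>
     rel_pmf (\<lambda>x a. \<exists>m' \<sigma>'. x = Some m' \<and> sim \<sigma>' m' \<and> Q a \<sigma>') (run w (compile b c) m) D))"

text \<open>Coupling with a point mass says that \<open>Q\<close> holds after every outcome and that
  no probability mass is missing.\<close>

definition wp :: "com \<Rightarrow> ((nat \<Rightarrow> nat) \<Rightarrow> bool) \<Rightarrow> (nat \<Rightarrow> nat) \<Rightarrow> bool" where
  "wp c Q \<sigma> \<longleftrightarrow> rwp c (return_pmf ()) (\<lambda>_. Q) \<sigma>"

lemma wp_rwp:
  assumes "wp c (Q a) \<sigma>" shows "rwp c (return_pmf a) Q \<sigma>"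
  using assms unfolding wp_def rwp_def by (auto simp: rel_pmf_return_pmf2)

lemma rwp_mono:
  assumes "rwp c D Q \<sigma>" "\<And>a \<sigma>. a \<in> set_pmf D \<Longrightarrow> Q a \<sigma> \<Longrightarrow> Q' a \<sigma>" shows "rwp c D Q' \<sigma>"
  unfolding rwp_def
proof (intro impI allI)
  fix m assume "16 + stack_com c \<le> b" "sim \<sigma> m"
  with assms(1) have "rel_pmf (\<lambda>x a. \<exists>m' \<sigma>'. x = Some m' \<and> sim \<sigma>' m' \<and> Q a \<sigma>') (run w (compile b c) m) D"
    unfolding rwp_def by blast
  then show "rel_pmf (\<lambda>x a. \<exists>m' \<sigma>'. x = Some m' \<and> sim \<sigma>' m' \<and> Q' a \<sigma>') (run w (compile b c) m) D"
    by (rule pmf.rel_mono_strong) (use assms(2) in blast)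
qed

lemma wp_mono:
  assumes "wp c Q \<sigma>" "\<And>\<sigma>. Q \<sigma> \<Longrightarrow> Q' \<sigma>" shows "wp c Q' \<sigma>"
  using assms unfolding wp_def by (rule rwp_mono)

lemma rel_bind_spmf:
  assumes "rel_pmf S p D1"
    and "\<And>x a. a \<in> set_pmf D1 \<Longrightarrow> S x a \<Longrightarrow> \<exists>m'. x = Some m' \<and> rel_pmf R (f m') (D2 a)"
  shows "rel_pmf R (bind_spmf p f) (bind_pmf D1 D2)"
proof -
  have "rel_pmf (\<lambda>x a. a \<in> set_pmf D1 \<and> S x a) p D1"
    using assms(1) by (rule pmf.rel_mono_strong) auto
  then show ?thesis
    unfolding bind_spmf_def by (rule rel_pmf_bindI) (use assms(2) in fastforce)
qed

lemma wp_Nop: "Q \<sigma> \<Longrightarrow> wp Nop Q \<sigma>"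
  unfolding wp_def rwp_def by (auto simp: run_Skip)

lemma wp_Put:
  assumes "safe \<sigma> e1" "safe \<sigma> e2" "in_mem (eval \<sigma> e1)" "Q (\<sigma>(eval \<sigma> e1 := eval \<sigma> e2))"
  shows "wp (Put e1 e2) Q \<sigma>"
  unfolding wp_def rwp_def
proof (intro impI allI)
  fix m assume st: "16 + stack_com (Put e1 e2) \<le> b" and m: "sim \<sigma> m"
  have "stack_exp e1 + 16 \<le> b" using st by simp
  from comp_exp_correct[OF assms(1) this _ m] obtain m1 where
    m1: "run w (compile_exp b 16 e1) m = return_spmf m1" "sim \<sigma> m1" "m1 ! 16 = eval \<sigma> e1" by auto
  have "stack_exp e2 + 17 \<le> b" using st by simp
  from comp_exp_correct[OF assms(2) this _ m1(2)] obtain m2 where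
    m2: "run w (compile_exp b 17 e2) m1 = return_spmf m2" "sim \<sigma> m2"
    "m2 ! 17 = eval \<sigma> e2" "\<forall>i<17. m2 ! i = m1 ! i" by auto
  have "17 < N" "17 < b" using st b_le stack_exp_pos[of e2] by auto
  with m1 m2 assms(3,4) show "rel_pmf (\<lambda>x a. \<exists>m' \<sigma>'. x = Some m' \<and> sim \<sigma>' m' \<and> Q \<sigma>')
          (run w (compile b (Put e1 e2)) m) (return_pmf ())"
    by (auto simp: run_Seq run_Do read_cell_def write_cell_def sim_def in_mem_def nth_list_update
        intro!: exI[of _ "\<sigma>(eval \<sigma> e1 := eval \<sigma> e2)"])
qed

lemma rwp_Then:
  assumes "rwp c1 D1 (\<lambda>a. rwp c2 (D2 a) Q) \<sigma>"
  shows "rwp (Then c1 c2) (bind_pmf D1 D2) Q \<sigma>"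
  unfolding rwp_def
proof (intro impI allI)
  fix m assume st: "16 + stack_com (Then c1 c2) \<le> b" and m: "sim \<sigma> m"
  have "rel_pmf (\<lambda>x a. \<exists>m' \<sigma>'. x = Some m' \<and> sim \<sigma>' m' \<and> rwp c2 (D2 a) Q \<sigma>')
      (run w (compile b c1) m) D1"
    using assms st m unfolding rwp_def by simp
  then show "rel_pmf (\<lambda>x a. \<exists>m' \<sigma>'. x = Some m' \<and> sim \<sigma>' m' \<and> Q a \<sigma>')
          (run w (compile b (Then c1 c2)) m) (bind_pmf D1 D2)"
    unfolding compile.simps run_Seq
    by (rule rel_bind_spmf) (use st in \<open>auto simp: rwp_def\<close>)
qed

lemma wp_Then: "wp c1 (wp c2 Q) \<sigma> \<Longrightarrow> wp (Then c1 c2) Q \<sigma>"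
  using rwp_Then[of c1 "return_pmf ()" c2 "\<lambda>_. return_pmf ()" "\<lambda>_. Q" \<sigma>]
  unfolding wp_def by (simp add: bind_return_pmf)

lemma rwp_If:
  assumes "safe \<sigma> e" "eval \<sigma> e \<noteq> 0 \<Longrightarrow> rwp c1 D Q \<sigma>" "eval \<sigma> e = 0 \<Longrightarrow> rwp c2 D Q \<sigma>"
  shows "rwp (If e c1 c2) D Q \<sigma>"
  unfolding rwp_def
proof (intro impI allI)
  fix m assume st: "16 + stack_com (If e c1 c2) \<le> b" and m: "sim \<sigma> m"
  have "stack_exp e + 16 \<le> b" using st by simp
  from comp_exp_correct[OF assms(1) this _ m] obtain m1 where
    m1: "run w (compile_exp b 16 e) m = return_spmf m1" "sim \<sigma> m1" "m1 ! 16 = eval \<sigma> e" by auto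
  have "16 < length m1" using st b_le m1 stack_exp_pos[of e] by (auto simp: sim_def)
  with m1 st assms(2,3) show "rel_pmf (\<lambda>x a. \<exists>m' \<sigma>'. x = Some m' \<and> sim \<sigma>' m' \<and> Q a \<sigma>')
          (run w (compile b (If e c1 c2)) m) D"
    by (auto simp: run_Seq run_Cond read_cell_def rwp_def)
qed

lemma wp_If:
  assumes "safe \<sigma> e" "eval \<sigma> e \<noteq> 0 \<Longrightarrow> wp c1 Q \<sigma>" "eval \<sigma> e = 0 \<Longrightarrow> wp c2 Q \<sigma>"
  shows "wp (If e c1 c2) Q \<sigma>"
  using assms unfolding wp_def by (rule rwp_If)

lemma rwp_Loop_done:
  assumes "safe \<sigma> e" "eval \<sigma> e = 0" "Q a \<sigma>"
  shows "rwp (Loop e c) (return_pmf a) Q \<sigma>"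
  unfolding rwp_def
proof (intro impI allI)
  fix m assume st: "16 + stack_com (Loop e c) \<le> b" and m: "sim \<sigma> m"
  have "stack_exp e + 16 \<le> b" using st by simp
  from comp_exp_correct[OF assms(1) this _ m] obtain m1 where
    m1: "run w (compile_exp b 16 e) m = return_spmf m1" "sim \<sigma> m1" "m1 ! 16 = eval \<sigma> e" by auto
  have "16 < length m1" using st b_le m1 stack_exp_pos[of e] by (auto simp: sim_def)
  with m1 st assms(2,3) show "rel_pmf (\<lambda>x a. \<exists>m' \<sigma>'. x = Some m' \<and> sim \<sigma>' m' \<and> Q a \<sigma>')
          (run w (compile b (Loop e c)) m) (return_pmf a)"
    by (subst compile.simps, subst run_Seq) (auto simp: run_While read_cell_def)
qed

text \<open>Only one round is unfolded; termination comes from the induction in which the rule is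
  applied. The law \<open>D2 a\<close> of the remaining rounds may depend on the ghost value
  \<open>a\<close> of this one.\<close>

lemma rwp_Loop_step:
  assumes "safe \<sigma> e" "eval \<sigma> e \<noteq> 0" "rwp c D1 (\<lambda>a. rwp (Loop e c) (D2 a) Q) \<sigma>"
  shows "rwp (Loop e c) (bind_pmf D1 D2) Q \<sigma>"
  unfolding rwp_def
proof (intro impI allI)
  fix m assume st: "16 + stack_com (Loop e c) \<le> b" and m: "sim \<sigma> m"
  let ?R = "\<lambda>x a. \<exists>m' \<sigma>'. x = Some m' \<and> sim \<sigma>' m' \<and> Q a \<sigma>'"
  let ?L = "While 16 (Seq (compile b c) (compile_exp b 16 e))"
  have "stack_exp e + 16 \<le> b" using st by simp
  from comp_exp_correct[OF assms(1) this _ m] obtain m1 where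
    m1: "run w (compile_exp b 16 e) m = return_spmf m1" "sim \<sigma> m1" "m1 ! 16 = eval \<sigma> e" by auto
  have "16 < length m1" using st b_le m1 stack_exp_pos[of e] by (auto simp: sim_def)
  then have "run w (compile b (Loop e c)) m =
      bind_spmf (run w (compile b c) m1) (run w (compile b (Loop e c)))"
    using m1 assms(2) unfolding compile.simps run_Seq[of w _ ?L] m1(1) return_bind_spmf
    by (subst run_While) (simp add: read_cell_def run_Seq)
  moreover have "rel_pmf (\<lambda>x a. \<exists>m' \<sigma>'. x = Some m' \<and> sim \<sigma>' m' \<and> rwp (Loop e c) (D2 a) Q \<sigma>')
      (run w (compile b c) m1) D1"
    using assms(3) st m1 unfolding rwp_def[of c] by simp
  then have "rel_pmf ?R (bind_spmf (run w (compile b c) m1) (run w (compile b (Loop e c))))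
      (bind_pmf D1 D2)"
    by (rule rel_bind_spmf) (use st in \<open>auto simp: rwp_def\<close>)
  ultimately show "rel_pmf ?R (run w (compile b (Loop e c)) m) (bind_pmf D1 D2)" by simp
qed

lemma wp_Loop_done: "safe \<sigma> e \<Longrightarrow> eval \<sigma> e = 0 \<Longrightarrow> Q \<sigma> \<Longrightarrow> wp (Loop e c) Q \<sigma>"
  unfolding wp_def by (rule rwp_Loop_done)

lemma wp_Loop_step:
  "safe \<sigma> e \<Longrightarrow> eval \<sigma> e \<noteq> 0 \<Longrightarrow> wp c (wp (Loop e c) Q) \<sigma> \<Longrightarrow> wp (Loop e c) Q \<sigma>"
  using rwp_Loop_step[of \<sigma> e c "return_pmf ()" "\<lambda>_. return_pmf ()" "\<lambda>_. Q"]
  unfolding wp_def by (simp add: bind_return_pmf)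

lemma rwp_Toss:
  assumes "in_mem i" "\<And>x. Q x (\<sigma>(i := of_bool x))"
  shows "rwp (Toss i) (bernoulli_pmf (1 / 2)) Q \<sigma>"
  unfolding rwp_def
proof (intro impI allI)
  fix m assume m: "sim \<sigma> m"
  let ?R = "\<lambda>x a. \<exists>m' \<sigma>'. x = Some m' \<and> sim \<sigma>' m' \<and> Q a \<sigma>'"
  have "run w (compile b (Toss i)) m = map_pmf (\<lambda>x. Some (m[i := of_bool x])) (bernoulli_pmf (1 / 2))"
    using m assms(1) w_pos
    by (auto simp: run_Do write_cell_def sim_def in_mem_def
        bernoulli_pmf_half_conv_pmf_of_set map_pmf_def of_bool_def
        simp flip: spmf_of_pmf_pmf_of_set intro!: bind_pmf_cong)
  moreover have "rel_pmf ?R (map_pmf (\<lambda>x. Some (m[i := of_bool x])) (bernoulli_pmf (1 / 2)))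
      (bernoulli_pmf (1 / 2))"
    unfolding pmf.rel_map(1)
  proof (rule rel_pmf_reflI)
    fix x
    have "sim (\<sigma>(i := of_bool x)) (m[i := of_bool x])"
      using m assms(1) by (auto simp: sim_def in_mem_def nth_list_update)
    then show "?R (Some (m[i := of_bool x])) x" using assms(2) by blast
  qed
  ultimately show "rel_pmf ?R (run w (compile b (Toss i)) m) (bernoulli_pmf (1 / 2))" by simp
qed

end

section \<open>Components as minimal closed sets of vertices\<close>

section \<open>Connected conn_comps\<close>

definition graph_on :: "nat \<Rightarrow> nat set set \<Rightarrow> bool" where
  "graph_on n E \<longleftrightarrow> (\<forall>e\<in>E. \<exists>u v. e = {u, v} \<and> u \<noteq> v \<and> u \<in> {1..n} \<and> v \<in> {1..n})"

definition nbrs :: "nat set set \<Rightarrow> nat \<Rightarrow> nat set" where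
  "nbrs E u = {v. {u, v} \<in> E}"

definition conn_comps :: "nat \<Rightarrow> nat set set \<Rightarrow> nat set set" where
  "conn_comps n E =
     {1..n} // {(u, v). u \<in> {1..n} \<and> v \<in> {1..n} \<and> (u, v) \<in> {(x, y). {x, y} \<in> E}\<^sup>*}"

text \<open>For a graph on \<open>{1..n}\<close>, the closed subsets of \<open>{1..n}\<close> are
  exactly the unions of components, so closedness alone does not single out a component.\<close>

definition closed_set :: "nat set set \<Rightarrow> nat set \<Rightarrow> bool" where
  "closed_set E T \<longleftrightarrow> (\<forall>u\<in>T. nbrs E u \<subseteq> T)"

lemma graph_on_empty: "graph_on n {}"
  by (simp add: graph_on_def)

lemma graph_on_edge:
  assumes "graph_on n E" "{u, v} \<in> E"
  shows "u \<noteq> v" "u \<in> {1..n}" "v \<in> {1..n}"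
  using assms unfolding graph_on_def by (force simp: doubleton_eq_iff)+

lemma nbrs_subset: "graph_on n E \<Longrightarrow> nbrs E u \<subseteq> {1..n}"
  using graph_on_edge unfolding nbrs_def by blast

lemma finite_nbrs: "graph_on n E \<Longrightarrow> finite (nbrs E u)"
  by (meson finite_atLeastAtMost finite_subset nbrs_subset)

lemma num_components_eq: "num_components n E = card (conn_comps n E)"
  by (simp add: num_components_def conn_comps_def)

lemma equiv_reachable:
  "equiv {1..n} {(u, v). u \<in> {1..n} \<and> v \<in> {1..n} \<and> (u, v) \<in> {(x, y). {x, y} \<in> E}\<^sup>*}"
proof -
  have "sym ({(x, y). {x, y} \<in> E}\<^sup>*)"
    by (rule sym_rtrancl) (auto simp: sym_def insert_commute)
  then show ?thesis
    by (auto simp: equiv_def refl_on_def sym_def intro!: transI)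
qed

lemma finite_components: "finite (conn_comps n E)"
  unfolding conn_comps_def by (rule finite_quotient) auto

lemma component_subset: "C \<in> conn_comps n E \<Longrightarrow> C \<subseteq> {1..n}"
  unfolding conn_comps_def quotient_def by auto

lemma component_nonempty: "C \<in> conn_comps n E \<Longrightarrow> C \<noteq> {}"
  unfolding conn_comps_def using in_quotient_imp_non_empty[OF equiv_reachable] by blast

lemma component_finite: "C \<in> conn_comps n E \<Longrightarrow> finite C"
  by (meson component_subset finite_atLeastAtMost finite_subset)

lemma components_disjoint:
  "C \<in> conn_comps n E \<Longrightarrow> D \<in> conn_comps n E \<Longrightarrow> C \<noteq> D \<Longrightarrow> C \<inter> D = {}"
  unfolding conn_comps_def using quotient_disj[OF equiv_reachable] by blast

lemma Union_components: "\<Union>(conn_comps n E) = {1..n}"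
  unfolding conn_comps_def by (rule Union_quotient[OF equiv_reachable])

lemma closed_set_component:
  assumes "graph_on n E" "C \<in> conn_comps n E"
  shows "closed_set E C"
  unfolding closed_set_def nbrs_def
proof (intro ballI subsetI CollectI)
  fix u v assume "u \<in> C" "v \<in> {v. {u, v} \<in> E}"
  then have "{u, v} \<in> E" by simp
  from \<open>C \<in> _\<close> obtain x where "C = {(u, v). u \<in> {1..n} \<and> v \<in> {1..n} \<and> (u, v) \<in> {(x, y). {x, y} \<in> E}\<^sup>*} `` {x}"
    unfolding conn_comps_def quotient_def by blast
  with \<open>u \<in> C\<close> graph_on_edge[OF assms(1) \<open>{u, v} \<in> E\<close>] \<open>{u, v} \<in> E\<close> show "v \<in> C"
    by (auto intro: rtrancl_into_rtrancl)
qed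

lemma component_in_closed_set:
  assumes "closed_set E T" "C \<in> conn_comps n E" "x \<in> C" "x \<in> T"
  shows "C \<subseteq> T"
proof
  fix y assume "y \<in> C"
  let ?r = "{(u, v). u \<in> {1..n} \<and> v \<in> {1..n} \<and> (u, v) \<in> {(x, y). {x, y} \<in> E}\<^sup>*}"
  have "(x, y) \<in> ?r"
    using assms(2,3) \<open>y \<in> C\<close> equiv_reachable[of n E] unfolding conn_comps_def
    by (meson in_quotient_imp_in_rel bot_least insert_subset)
  then have "(x, y) \<in> {(x, y). {x, y} \<in> E}\<^sup>*" by simp
  then show "y \<in> T"
    by induction (use assms(1,4) in \<open>auto simp: closed_set_def nbrs_def\<close>)
qed

text \<open>A closed set contains the whole component of any of its points. That component has at
  least \<open>s\<close> elements and \<open>T\<close> at most \<open>s\<close>, so the two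
  coincide.\<close>

lemma closed_set_eq_component:
  assumes "closed_set E T" "T \<subseteq> {1..n}" "T \<noteq> {}" "finite T" "card T \<le> s"
    and small: "\<And>C. C \<in> conn_comps n E \<Longrightarrow> C \<subseteq> T \<Longrightarrow> s \<le> card C"
  shows "T \<in> conn_comps n E \<and> card T = s"
proof -
  obtain x where "x \<in> T" using assms by auto
  then obtain C where C: "C \<in> conn_comps n E" "x \<in> C" using Union_components[of n E] assms by blast
  then have "C \<subseteq> T" using component_in_closed_set assms \<open>x \<in> T\<close> by blast
  with small[OF C(1)] have "C = T" using assms
    by (metis card_seteq le_trans)
  then show ?thesis using C small assms by fastforce
qed

lemma card_large_components:
  "(t + 1) * card {C \<in> conn_comps n E. t < card C} \<le> n"
proof -
  let ?L = "{C \<in> conn_comps n E. t < card C}"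
  have "(t + 1) * card ?L = (\<Sum>C\<in>?L. t + 1)" by simp
  also have "\<dots> \<le> (\<Sum>C\<in>?L. card C)" by (intro sum_mono) auto
  also have "\<dots> = card (\<Union>?L)"
    by (rule card_Union_disjoint[symmetric])
       (auto simp: pairwise_def disjnt_def dest: components_disjoint component_finite)
  also have "\<dots> \<le> card {1..n}"
    by (rule card_mono) (use component_subset in blast)+
  finally show ?thesis by simp
qed

lemma card_components_le: "card (conn_comps n E) \<le> n"
proof -
  \<comment> \<open>With \<open>t = 0\<close> the count of large components covers all of them,
    since none is empty.\<close>
  have "{C \<in> conn_comps n E. 0 < card C} = conn_comps n E"
    using component_nonempty component_finite by (auto simp: card_gt_0_iff)
  then show ?thesis using card_large_components[of 0 n E] by simp
qed

text \<open>Integer sums of squares vanish termwise, so the polynomial \<open>\<Prod>y\<in>T. (v - y)\<^sup>2\<close>, which is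
  determined by power sums of neighbours, certifies that no edge leaves \<open>T\<close>.\<close>

lemma closed_set_iff_sum:
  fixes x :: "nat \<Rightarrow> nat"
  assumes "graph_on n E"
  shows "closed_set E (x ` {..<s}) \<longleftrightarrow>
    (\<Sum>l<s. \<Sum>v\<in>nbrs E (x l). (\<Prod>i<s. (int v - int (x i))\<^sup>2)) = 0"
proof -
  have "(\<Sum>l<s. \<Sum>v\<in>nbrs E (x l). (\<Prod>i<s. (int v - int (x i))\<^sup>2)) = 0 \<longleftrightarrow>
    (\<forall>l<s. (\<Sum>v\<in>nbrs E (x l). (\<Prod>i<s. (int v - int (x i))\<^sup>2)) = 0)"
    by (subst sum_nonneg_eq_0_iff) (auto intro!: sum_nonneg prod_nonneg)
  also have "\<dots> \<longleftrightarrow> (\<forall>l<s. \<forall>v\<in>nbrs E (x l). (\<Prod>i<s. (int v - int (x i))\<^sup>2) = 0)"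
    by (subst sum_nonneg_eq_0_iff) (auto intro!: prod_nonneg finite_nbrs[OF assms])
  also have "\<dots> \<longleftrightarrow> closed_set E (x ` {..<s})"
    by (auto simp: closed_set_def) 
  finally show ?thesis by simp
qed

subsection \<open>Streams\<close>

lemma graph_on_apply_update:
  assumes "graph_on n E" "legal_update n E x" shows "graph_on n (apply_update E x)"
  using assms by (cases x) (auto simp: graph_on_def)

lemma dynamic_stream_snoc:
  "dynamic_stream n (xs @ [x]) \<longleftrightarrow> dynamic_stream n xs \<and> legal_update n (stream_graph xs) x"
  unfolding dynamic_stream_def by (auto simp: nth_append less_Suc_eq)

lemma stream_graph_snoc: "stream_graph (xs @ [x]) = apply_update (stream_graph xs) x"
  by (simp add: stream_graph_def)

lemma graph_on_stream: "dynamic_stream n xs \<Longrightarrow> graph_on n (stream_graph xs)"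
  by (induction xs rule: rev_induct)
     (auto simp: dynamic_stream_snoc stream_graph_snoc graph_on_apply_update stream_graph_def
        graph_on_empty)

section \<open>Mean, variance and concentration of the sampled count\<close>

section \<open>The estimator\<close>

definition estimate :: "nat \<Rightarrow> nat set set \<Rightarrow> nat \<Rightarrow> nat \<Rightarrow> nat set \<Rightarrow> nat" where
  "estimate n E t P R = (\<Sum>C | C \<in> conn_comps n E \<and> card C \<le> t \<and> C \<subseteq> R. P ^ card C)"

definition sample :: "nat \<Rightarrow> nat \<Rightarrow> (nat \<Rightarrow> bool) pmf" where
  "sample n P = Pi_pmf {1..n} False (\<lambda>_. bernoulli_pmf (1 / real P))"

lemma finite_sample: "finite (set_pmf (sample n P))"
  unfolding sample_def
  by (rule finite_subset[OF set_Pi_pmf_subset' finite_PiE_dflt]) auto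

lemma integrable_sample: "integrable (measure_pmf (sample n P)) (f :: _ \<Rightarrow> real)"
  by (rule integrable_measure_pmf_finite[OF finite_sample])

lemma expectation_sample_all:
  assumes "S \<subseteq> {1..n}" "1 \<le> P"
  shows "measure_pmf.expectation (sample n P) (\<lambda>f. of_bool (\<forall>v\<in>S. f v)) = (1 / real P) ^ card S"
proof -
  have "finite S" using assms finite_subset by blast
  \<comment> \<open>The indicator becomes a product over all of \<open>{1..n}\<close>, with factor
    \<open>1\<close> outside \<open>S\<close>, which is the form that independence of the
    coordinates can integrate.\<close>
  have eq: "(of_bool (\<forall>v\<in>S. f v) :: real) = (\<Prod>v\<in>{1..n}. if v \<in> S then of_bool (f v) else 1)" for f
  proof -
    have "(\<Prod>v\<in>{1..n}. if v \<in> S then (of_bool (f v) :: real) else 1) = (\<Prod>v\<in>S. of_bool (f v))"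
      using assms by (subst prod.inter_restrict[symmetric]) (auto simp: Int_absorb1)
    also have "\<dots> = of_bool (\<forall>v\<in>S. f v)"
      using \<open>finite S\<close> by (induction S rule: finite_induct) auto
    finally show ?thesis by simp
  qed
  have "measure_pmf.expectation (sample n P) (\<lambda>f. of_bool (\<forall>v\<in>S. f v) :: real) =
      measure_pmf.expectation (sample n P) (\<lambda>f. \<Prod>v\<in>{1..n}. if v \<in> S then of_bool (f v) else 1)"
    by (rule Bochner_Integration.integral_cong[OF refl eq])
  also have "\<dots> =
      (\<Prod>v\<in>{1..n}. measure_pmf.expectation (bernoulli_pmf (1 / real P))
        (\<lambda>x. if v \<in> S then of_bool x else 1 :: real))"
    unfolding sample_def
    by (rule expectation_prod_Pi_pmf[where f = "\<lambda>v x. if v \<in> S then of_bool x else 1"]) (auto intro: integrable_measure_pmf_finite)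
  also have "\<dots> = (\<Prod>v\<in>{1..n}. if v \<in> S then 1 / real P else 1)"
    using assms by (intro prod.cong) auto
  also have "\<dots> = (\<Prod>v\<in>S. 1 / real P)"
    using assms by (subst prod.inter_restrict[symmetric]) (auto simp: Int_absorb1)
  finally show ?thesis by simp
qed

text \<open>Disjoint sets are sampled independently, so their centred weights are
  uncorrelated.\<close>

lemma expectation_sample_product:
  assumes "S \<subseteq> {1..n}" "T \<subseteq> {1..n}" "S \<inter> T = {}" "1 \<le> P"
  shows "measure_pmf.expectation (sample n P)
     (\<lambda>f. (real P ^ card S * of_bool (\<forall>v\<in>S. f v) - 1) * (real P ^ card T * of_bool (\<forall>v\<in>T. f v) - 1)) = 0"
proof -
  have fin: "finite S" "finite T" using assms finite_subset by blast+
  \<comment> \<open>Each power of \<open>P\<close> cancels the probability of its event, so the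
    means of the four terms are \<open>1\<close>, \<open>-1\<close>, \<open>-1\<close> and
    \<open>1\<close>.\<close>
  have "(\<lambda>f. (real P ^ card S * of_bool (\<forall>v\<in>S. f v) - 1) * (real P ^ card T * of_bool (\<forall>v\<in>T. f v) - 1))
    = (\<lambda>f. real P ^ card (S \<union> T) * of_bool (\<forall>v\<in>S \<union> T. f v) - real P ^ card S * of_bool (\<forall>v\<in>S. f v)
        - real P ^ card T * of_bool (\<forall>v\<in>T. f v) + 1)"
    using fin assms(3) by (auto simp: fun_eq_iff card_Un_disjoint power_add algebra_simps)
  then show ?thesis
    using assms by (simp add: integrable_sample expectation_sample_all power_divide del: ball_Un)
qed

lemma expectation_sample_square:
  assumes "S \<subseteq> {1..n}" "1 \<le> P"
  shows "measure_pmf.expectation (sample n P)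
     (\<lambda>f. (real P ^ card S * of_bool (\<forall>v\<in>S. f v) - 1) * (real P ^ card S * of_bool (\<forall>v\<in>S. f v) - 1))
     = real P ^ card S - 1"
proof -
  \<comment> \<open>With \<open>W = real P ^ card S\<close> the event has probability
    \<open>1 / W\<close>, and \<open>(W * W - 2 * W) / W + 1 = W - 1\<close>.\<close>
  have "(\<lambda>f. (real P ^ card S * of_bool (\<forall>v\<in>S. f v) - 1) * (real P ^ card S * of_bool (\<forall>v\<in>S. f v) - 1))
    = (\<lambda>f. (real P ^ card S * real P ^ card S - 2 * real P ^ card S) * of_bool (\<forall>v\<in>S. f v) + 1)"
    by (auto simp: fun_eq_iff algebra_simps)
  then show ?thesis
    using assms by (simp add: integrable_sample expectation_sample_all power_divide field_simps)
qed

text \<open>Distinct components are disjoint, so only the diagonal of the double sum survives, with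
  at most \<open>n\<close> terms. The \<open>- 1\<close> is kept because it makes the variance
  vanish for \<open>P = 1\<close>, the case in which \<open>P ^ t\<close> need not be small against
  \<open>n\<close>.\<close>

lemma variance_estimate:
  assumes "1 \<le> P"
  shows "measure_pmf.expectation (sample n P)
      (\<lambda>f. (real (estimate n E t P {v \<in> {1..n}. f v})
             - real (card {C \<in> conn_comps n E. card C \<le> t}))\<^sup>2) \<le> real n * (real P ^ t - 1)"
proof -
  let ?S = "{C \<in> conn_comps n E. card C \<le> t}"
  let ?g = "\<lambda>C f. real P ^ card C * of_bool (\<forall>v\<in>C. f v) - 1"
  let ?E = "measure_pmf.expectation (sample n P)"
  have fin: "finite ?S" by (simp add: finite_components)
  have "real (estimate n E t P {v \<in> {1..n}. f v}) = (\<Sum>C\<in>?S. real P ^ card C * of_bool (\<forall>v\<in>C. f v))"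
    (is "_ = ?r") for f
  proof -
    have "real (estimate n E t P {v \<in> {1..n}. f v}) =
        (\<Sum>C | C \<in> ?S \<and> C \<subseteq> {v \<in> {1..n}. f v}. real P ^ card C)"
      unfolding estimate_def by (simp add: conj_assoc)
    also have "\<dots> = (\<Sum>C\<in>?S. if C \<subseteq> {v \<in> {1..n}. f v} then real P ^ card C else 0)"
      by (rule sum.inter_filter[OF fin])
    also have "\<dots> = ?r"
    proof (intro sum.cong refl)
      fix C assume "C \<in> ?S"
      then have "C \<subseteq> {v \<in> {1..n}. f v} \<longleftrightarrow> (\<forall>v\<in>C. f v)" using component_subset[of C n E] by blast
      then show "(if C \<subseteq> {v \<in> {1..n}. f v} then real P ^ card C else 0) =
          real P ^ card C * of_bool (\<forall>v\<in>C. f v)" by simp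
    qed
    finally show ?thesis .
  qed
  then have "?E (\<lambda>f. (real (estimate n E t P {v \<in> {1..n}. f v}) - real (card ?S))\<^sup>2)
      = ?E (\<lambda>f. (\<Sum>C\<in>?S. ?g C f)\<^sup>2)"
    by (simp add: sum_subtractf)
  also have "\<dots> = (\<Sum>C\<in>?S. \<Sum>D\<in>?S. ?E (\<lambda>f. ?g C f * ?g D f))"
    by (simp add: power2_eq_square sum_product integrable_sample)
  also have "\<dots> = (\<Sum>C\<in>?S. \<Sum>D\<in>?S. if D = C then real P ^ card C - 1 else 0)"
  proof (intro sum.cong refl)
    fix C D assume "C \<in> ?S" "D \<in> ?S"
    then show "?E (\<lambda>f. ?g C f * ?g D f) = (if D = C then real P ^ card C - 1 else 0)"
      using expectation_sample_product[of C n D P] expectation_sample_square[of C n P] assms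
        component_subset[of C n E] component_subset[of D n E] components_disjoint[of C n E D]
      by auto
  qed
  also have "\<dots> = (\<Sum>C\<in>?S. real P ^ card C - 1)"
    using fin by (intro sum.cong refl) simp
  also have "\<dots> \<le> (\<Sum>C\<in>?S. real P ^ t - 1)"
    by (intro sum_mono) (use assms in \<open>auto intro: power_increasing\<close>)
  also have "\<dots> = real (card ?S) * (real P ^ t - 1)" by simp
  also have "\<dots> \<le> real n * (real P ^ t - 1)"
  proof -
    have "card ?S \<le> card (conn_comps n E)" by (intro card_mono finite_components) auto
    then have "card ?S \<le> n" using card_components_le[of n E] by linarith
    then show ?thesis using assms by (intro mult_right_mono) auto
  qed
  finally show ?thesis .
qed

lemma expectation_sample_card:
  assumes "1 \<le> P"
  shows "measure_pmf.expectation (sample n P) (\<lambda>f. real (card {v \<in> {1..n}. f v})) = real n / real P"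
proof -
  have "real (card {v \<in> {1..n}. f v}) = (\<Sum>v\<in>{1..n}. of_bool (\<forall>x\<in>{v}. f x))" for f
    by (simp add: of_bool_def sum.If_cases Int_def)
  then have "measure_pmf.expectation (sample n P) (\<lambda>f. real (card {v \<in> {1..n}. f v})) =
      (\<Sum>v\<in>{1..n}. measure_pmf.expectation (sample n P) (\<lambda>f. of_bool (\<forall>x\<in>{v}. f x)))"
    by (simp only: Bochner_Integration.integral_sum integrable_sample)
  also have "\<dots> = (\<Sum>v\<in>{1..n}. 1 / real P)"
    by (intro sum.cong refl, subst expectation_sample_all) (use assms in auto)
  finally show ?thesis by simp
qed

text \<open>Components with more than \<open>t\<close> vertices are ignored by the estimator; there
  are at most \<open>n / (t + 1)\<close> of them, which is the second summand of the error
  budget.\<close>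

lemma estimate_close:
  assumes "\<bar>real (estimate n E t P R) - real (card {C \<in> conn_comps n E. card C \<le> t})\<bar> \<le> \<delta> * real n"
    and "\<delta> + 1 / (real t + 1) \<le> \<epsilon>"
  shows "\<bar>real (estimate n E t P R) - real (num_components n E)\<bar> \<le> \<epsilon> * real n"
proof -
  let ?S = "{C \<in> conn_comps n E. card C \<le> t}" and ?L = "{C \<in> conn_comps n E. t < card C}"
  have "conn_comps n E = ?S \<union> ?L" by auto
  moreover have "card (?S \<union> ?L) = card ?S + card ?L"
    by (rule card_Un_disjoint) (auto simp: finite_components)
  ultimately have "num_components n E = card ?S + card ?L"
    by (simp add: num_components_eq)
  moreover have "real (card ?L) \<le> 1 / (real t + 1) * real n"
  proof -
    have "real ((t + 1) * card ?L) \<le> real n" using card_large_components[of t n E] of_nat_mono by blast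
    then show ?thesis by (simp add: field_simps)
  qed
  moreover have "\<delta> * real n + 1 / (real t + 1) * real n \<le> \<epsilon> * real n"
    using mult_right_mono[OF assms(2), of "real n"] by (simp add: algebra_simps)
  moreover have "0 \<le> 1 / (real t + 1) * real n" by simp
  ultimately show ?thesis using assms(1) by linarith
qed

text \<open>Two bad events of probability at most \<open>1 / 6\<close> each: the sample exceeds six
  times its mean \<open>n / P\<close> (Markov), or the estimate is off by
  \<open>\<delta> * n\<close> (Chebyshev). For the latter the variance is at most
  \<open>n * n / c\<close>, so the probability is at most
  \<open>1 / (c * \<delta>\<^sup>2)\<close>.\<close>

theorem sample_good:
  fixes c :: real
  assumes "1 \<le> n" "1 \<le> P" "P = 1 \<or> c * real P ^ t \<le> real n"
    and "0 < \<delta>" "6 \<le> c * \<delta>\<^sup>2" "\<delta> + 1 / (real t + 1) \<le> \<epsilon>"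
  shows "measure (sample n P) {f. card {v \<in> {1..n}. f v} \<le> 6 * n div P \<and>
      \<bar>real (estimate n E t P {v \<in> {1..n}. f v}) - real (num_components n E)\<bar> \<le> \<epsilon> * real n} \<ge> 2 / 3"
proof -
  let ?Y = "\<lambda>f. real (estimate n E t P {v \<in> {1..n}. f v}) - real (card {C \<in> conn_comps n E. card C \<le> t})"
  let ?K = "\<lambda>f. real (card {v \<in> {1..n}. f v})"
  let ?B1 = "{f. 6 * real n / real P \<le> ?K f}" and ?B2 = "{f. (\<delta> * real n)\<^sup>2 \<le> (?Y f)\<^sup>2}"
  let ?G = "{f. card {v \<in> {1..n}. f v} \<le> 6 * n div P \<and>
      \<bar>real (estimate n E t P {v \<in> {1..n}. f v}) - real (num_components n E)\<bar> \<le> \<epsilon> * real n}"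
  have c: "0 < c" using assms by (smt (verit) zero_less_mult_pos2 zero_less_power)
  have "measure (sample n P) ?B1 \<le> real n / real P / (6 * real n / real P)"
    using integral_Markov_inequality_measure[of "sample n P" ?K UNIV "6 * real n / real P"]
      expectation_sample_card[OF assms(2), of n] assms by (simp add: integrable_sample)
  then have b1: "measure (sample n P) ?B1 \<le> 1 / 6" using assms by simp
  have "measure (sample n P) ?B2 \<le> measure_pmf.expectation (sample n P) (\<lambda>f. (?Y f)\<^sup>2) / (\<delta> * real n)\<^sup>2"
    using integral_Markov_inequality_measure[of "sample n P" "\<lambda>f. (?Y f)\<^sup>2" UNIV "(\<delta> * real n)\<^sup>2"]
      assms by (simp add: integrable_sample)
  also have "\<dots> \<le> real n * (real P ^ t - 1) / (\<delta> * real n)\<^sup>2"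
    using variance_estimate[OF assms(2), of n E t] by (intro divide_right_mono) auto
  also have "\<dots> \<le> real n * (real n / c) / (\<delta> * real n)\<^sup>2"
  proof -
    have "real P ^ t - 1 \<le> real n / c"
      using assms(3)
    proof
      assume "c * real P ^ t \<le> real n"
      then have "real P ^ t \<le> real n / c" using c by (simp add: field_simps)
      then show ?thesis by simp
    qed (use c in simp)
    then show ?thesis by (intro divide_right_mono mult_left_mono) auto
  qed
  also have "\<dots> = 1 / (c * \<delta>\<^sup>2)" using assms c by (simp add: field_simps power2_eq_square)
  also have "\<dots> \<le> 1 / 6" using assms by (intro divide_left_mono) auto
  finally have b2: "measure (sample n P) ?B2 \<le> 1 / 6" .
  have "- ?G \<subseteq> ?B1 \<union> ?B2"
  proof
    fix f assume "f \<in> - ?G"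
    then consider "6 * n div P < card {v \<in> {1..n}. f v}" | "\<not> \<bar>?Y f\<bar> \<le> \<delta> * real n"
      using estimate_close assms(6) by fastforce
    then show "f \<in> ?B1 \<union> ?B2"
    proof cases
      case 1
      then have "6 * n < card {v \<in> {1..n}. f v} * P" using assms by (simp add: div_less_iff_less_mult)
      then have "6 * real n < ?K f * real P" by (metis of_nat_less_iff of_nat_mult of_nat_numeral)
      then show ?thesis using assms by (simp add: field_simps)
    next
      case 2
      then have "\<bar>\<delta> * real n\<bar> \<le> \<bar>?Y f\<bar>" using assms by simp
      then have "(\<delta> * real n)\<^sup>2 \<le> (?Y f)\<^sup>2" by (simp only: abs_le_square_iff)
      then show ?thesis by simp
    qed
  qed
  then have "measure (sample n P) (- ?G) \<le> measure (sample n P) ?B1 + measure (sample n P) ?B2"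
    by (intro order_trans[OF measure_pmf.finite_measure_mono measure_Un_le]) auto
  then have "measure (sample n P) (- ?G) \<le> 1 / 3" using b1 b2 by simp
  then show ?thesis
    using measure_pmf.prob_compl[of ?G "sample n P"] by (simp add: Compl_eq_Diff_UNIV)
qed

section \<open>Loop rules, and moments computed modulo \<open>2 ^ w\<close>\<close>

section \<open>Derived program constructs\<close>

definition For :: "nat \<Rightarrow> exp \<Rightarrow> com \<Rightarrow> com" where
  "For i e c = Then (Asg i (Num 0))
     (Loop (Bin Less (Var i) e) (Then c (Asg i (Bin Add (Var i) (Num 1)))))"

text \<open>Iteration at compile time, for ranges fixed by \<open>t\<close>: the index may then
  appear in the program as an exponent or a field offset.\<close>

primrec unroll :: "nat \<Rightarrow> (nat \<Rightarrow> com) \<Rightarrow> com" where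
  "unroll 0 f = Nop"
| "unroll (Suc n) f = Then (unroll n f) (f n)"

primrec pow_exp :: "exp \<Rightarrow> nat \<Rightarrow> exp" where
  "pow_exp e 0 = Num 1"
| "pow_exp e (Suc k) = Bin Mul e (pow_exp e k)"

primrec sum_exp :: "nat \<Rightarrow> (nat \<Rightarrow> exp) \<Rightarrow> exp" where
  "sum_exp 0 f = Num 0"
| "sum_exp (Suc s) f = Bin Add (sum_exp s f) (f s)"

text \<open>If \<open>S k\<close> is the \<open>k\<close>-th moment of a measure, this is the \<open>k\<close>-th moment of the measure with
  density \<open>\<Prod>y\<leftarrow>ys. (v - y)\<close>.\<close>

fun moment_exp :: "exp list \<Rightarrow> (nat \<Rightarrow> exp) \<Rightarrow> nat \<Rightarrow> exp" where
  "moment_exp [] S k = S k"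
| "moment_exp (y # ys) S k =
     Bin Sub (moment_exp ys S (Suc k)) (Bin Mul y (moment_exp ys S k))"

context ram
begin

lemma in_mem_var [simp]: "i < 16 \<Longrightarrow> in_mem i"
  using b_ge b_le by (simp add: in_mem_def)

lemma var_mod [simp]: "(i::nat) < 16 \<Longrightarrow> i mod 2 ^ w = i"
  using b_ge b_le N_le by simp

lemma w_gt_0 [simp]: "0 < w"
  using w_pos by (cases w) auto

lemma eval_pow_exp: "eval \<sigma> (pow_exp e k) = eval \<sigma> e ^ k mod 2 ^ w"
  by (induction k) (auto simp: mod_mult_right_eq)

lemma safe_pow_exp [simp]: "safe \<sigma> e \<Longrightarrow> safe \<sigma> (pow_exp e k)"
  by (induction k) auto

lemma eval_sum_exp: "eval \<sigma> (sum_exp s f) = (\<Sum>l<s. eval \<sigma> (f l)) mod 2 ^ w"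
  by (induction s) (auto simp: mod_add_left_eq)

lemma safe_sum_exp: "(\<And>l. l < s \<Longrightarrow> safe \<sigma> (f l)) \<Longrightarrow> safe \<sigma> (sum_exp s f)"
  by (induction s) auto

lemma safe_moment_exp:
  "(\<And>y. y \<in> set ys \<Longrightarrow> safe \<sigma> y) \<Longrightarrow> (\<And>j. j \<le> k + length ys \<Longrightarrow> safe \<sigma> (S j)) \<Longrightarrow>
   safe \<sigma> (moment_exp ys S k)"
  by (induction ys arbitrary: k) auto

lemma int_Sub_word:
  assumes "y < 2 ^ w"
  shows "int (binop_word w Sub x y) mod 2 ^ w = (int x - int y) mod 2 ^ w"
proof -
  have "int (x + 2 ^ w - y) = int x - int y + 2 ^ w" using assms by (simp add: of_nat_diff)
  then show ?thesis by (simp add: zmod_int)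
qed

text \<open>The recursion is \<open>A (v ^ k * (v - y) * g) = A (v ^ Suc k * g) - y * A (v ^ k *
  g)\<close> for a linear functional \<open>A\<close>. It is stated for integers modulo
  \<open>2 ^ w\<close>, since intermediate differences can be negative and products can
  overflow.\<close>

lemma eval_moment_exp:
  fixes A :: "(int \<Rightarrow> int) \<Rightarrow> int"
  assumes lin: "\<And>f g y. A (\<lambda>v. f v - y * g v) = A f - y * A g"
    and S: "\<And>j. j \<le> k + length ys \<Longrightarrow> int (eval \<sigma> (S j)) mod 2 ^ w = A (\<lambda>v. v ^ j) mod 2 ^ w"
  shows "int (eval \<sigma> (moment_exp ys S k)) mod 2 ^ w =
    A (\<lambda>v. v ^ k * (\<Prod>y\<leftarrow>ys. v - int (eval \<sigma> y))) mod 2 ^ w"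
  using S
proof (induction ys arbitrary: k)
  case Nil
  then show ?case by simp
next
  case (Cons y ys)
  let ?g = "\<lambda>k v. v ^ k * (\<Prod>y\<leftarrow>ys. v - int (eval \<sigma> y))"
  let ?e = "\<lambda>k. eval \<sigma> (moment_exp ys S k)"
  have IH: "int (?e k) mod 2 ^ w = A (?g k) mod 2 ^ w"
    "int (?e (Suc k)) mod 2 ^ w = A (?g (Suc k)) mod 2 ^ w"
    by (rule Cons.IH; use Cons.prems in simp)+
  have "int (eval \<sigma> (moment_exp (y # ys) S k)) mod 2 ^ w =
      (int (?e (Suc k)) - int (eval \<sigma> y * ?e k mod 2 ^ w)) mod 2 ^ w"
    using int_Sub_word[of "eval \<sigma> y * ?e k mod 2 ^ w" "?e (Suc k)"] by simp
  also have "\<dots> = (int (?e (Suc k)) - int (eval \<sigma> y) * int (?e k)) mod 2 ^ w"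
    by (simp add: zmod_int mod_diff_right_eq)
  also have "\<dots> = (A (?g (Suc k)) - int (eval \<sigma> y) * A (?g k)) mod 2 ^ w"
    by (intro mod_diff_cong mod_mult_cong IH refl)
  also have "A (?g (Suc k)) - int (eval \<sigma> y) * A (?g k) = A (\<lambda>v. ?g (Suc k) v - int (eval \<sigma> y) * ?g k v)"
    by (rule lin[symmetric])
  also have "(\<lambda>v. ?g (Suc k) v - int (eval \<sigma> y) * ?g k v) =
      (\<lambda>v. v ^ k * (\<Prod>y\<leftarrow>y # ys. v - int (eval \<sigma> y)))"
    by (simp add: fun_eq_iff algebra_simps)
  finally show ?case .
qed

lemma wp_unroll:
  assumes "I 0 \<sigma>" "\<And>k \<sigma>. k < m \<Longrightarrow> I k \<sigma> \<Longrightarrow> wp (f k) (I (Suc k)) \<sigma>"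
  shows "wp (unroll m f) (I m) \<sigma>"
  using assms(2)
proof (induction m)
  case 0
  then show ?case using assms(1) by (simp add: wp_Nop)
next
  case (Suc m)
  then have "wp (unroll m f) (I m) \<sigma>" by simp
  then have "wp (unroll m f) (wp (f m) (I (Suc m))) \<sigma>"
    by (rule wp_mono) (use Suc.prems in auto)
  then show ?case by (simp add: wp_Then)
qed

text \<open>The bound \<open>e\<close> is evaluated anew in every round, so the invariant has to fix
  its value; \<open>M < 2 ^ w\<close> keeps the counter from wrapping.\<close>

lemma wp_For:
  assumes i: "i < 16" and M: "M < 2 ^ w"
    and init: "I 0 (\<sigma>(i := 0))"
    and bound: "\<And>k \<sigma>. I k \<sigma> \<Longrightarrow> safe \<sigma> e \<and> eval \<sigma> e = M"
    and step: "\<And>k \<sigma>. k < M \<Longrightarrow> \<sigma> i = k \<Longrightarrow> I k \<sigma> \<Longrightarrow>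
      wp c (\<lambda>\<sigma>'. \<sigma>' i = k \<and> I (Suc k) (\<sigma>'(i := Suc k))) \<sigma>"
    and final: "\<And>\<sigma>. I M \<sigma> \<Longrightarrow> Q \<sigma>"
  shows "wp (For i e c) Q \<sigma>"
proof -
  let ?L = "Loop (Bin Less (Var i) e) (Then c (Asg i (Bin Add (Var i) (Num 1))))"
  have "wp ?L Q \<sigma>" if "k \<le> M" "\<sigma> i = k" "I k \<sigma>" for k \<sigma>
    using that
  proof (induction "M - k" arbitrary: k \<sigma>)
    case 0
    then have "k = M" by simp
    with 0 bound[of k \<sigma>] final i show ?case
      by (intro wp_Loop_done) auto
  next
    case (Suc d)
    then have k: "k < M" by simp
    have b: "safe \<sigma> e" "eval \<sigma> e = M" using bound Suc.prems by auto
    show ?case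
    proof (rule wp_Loop_step)
      show "wp (Then c (Asg i (Bin Add (Var i) (Num 1)))) (wp ?L Q) \<sigma>"
      proof (rule wp_Then, rule wp_mono[OF step[OF k Suc.prems(2,3)]])
        fix \<sigma>' assume \<sigma>': "\<sigma>' i = k \<and> I (Suc k) (\<sigma>'(i := Suc k))"
        have "wp ?L Q (\<sigma>'(i := Suc k))"
          by (rule Suc.hyps(1)) (use Suc.hyps(2) k \<sigma>' in auto)
        then show "wp (Asg i (Bin Add (Var i) (Num 1))) (wp ?L Q) \<sigma>'"
          using i \<sigma>' k M by (intro wp_Put) auto
      qed
    qed (use b k i Suc.prems in auto)
  qed
  from this[of 0 "\<sigma>(i := 0)"] init show ?thesis
    unfolding For_def using i by (intro wp_Then wp_Put) auto
qed

end

section \<open>The sketch of power sums and its maintenance\<close>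

section \<open>The algorithm\<close>

text \<open>Cell \<open>4\<close> holds the inverse sampling rate \<open>P\<close> and cell \<open>6\<close> the number of sampled vertices. The
  array has one record per sampled vertex \<open>u\<close>: the name of \<open>u\<close>, a mark, and the power sums
  \<open>\<Sum>v\<in>nbrs E u. v ^ k\<close> for \<open>k \<le> 2 * t\<close>. The estimate is recomputed after every update, in
  cell \<open>0\<close>, so that nothing is left to be done at the end of the stream.\<close>

definition Adr :: "nat \<Rightarrow> exp \<Rightarrow> nat \<Rightarrow> exp" where
  "Adr t e k = Bin Add (Bin Add Base (Bin Mul e (Num (2 * t + 3)))) (Num k)"

text \<open>The tuples of \<open>s\<close> records are enumerated by a counter in cell \<open>11\<close>, read in base \<open>r\<close>.\<close>

definition digit :: "nat \<Rightarrow> nat \<Rightarrow> nat \<Rightarrow> nat" where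
  "digit c r l = c div r ^ l mod r"

definition digit_exp :: "nat \<Rightarrow> exp" where
  "digit_exp l = Bin Mod (Bin Div (Var 11) (pow_exp (Var 6) l)) (Var 6)"

definition field_exp :: "nat \<Rightarrow> nat \<Rightarrow> nat \<Rightarrow> exp" where
  "field_exp t k l = At (Adr t (digit_exp l) k)"

text \<open>Every vertex is listed twice, which makes the density a product of squares. Moments are
  linear in the measure, so the power sums of all members are added before the recursion, which then
  runs once for the whole tuple.\<close>

definition closed_exp :: "nat \<Rightarrow> nat \<Rightarrow> exp" where
  "closed_exp t s = moment_exp (map (field_exp t 0) ([0..<s] @ [0..<s]))
     (\<lambda>k. sum_exp s (field_exp t (2 + k))) 0"

text \<open>The product of the two bits is a conjunction: no edge leaves the tuple, and no member is
  marked as part of a component counted earlier.\<close>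

definition test_exp :: "nat \<Rightarrow> nat \<Rightarrow> exp" where
  "test_exp t s = Bin Mul (Bin Eq (closed_exp t s) (Num 0))
     (Bin Eq (sum_exp s (field_exp t 1)) (Num 0))"

definition hit_com :: "nat \<Rightarrow> nat \<Rightarrow> com" where
  "hit_com t s = Then (unroll s (\<lambda>l. Put (Adr t (digit_exp l) 1) (Num 1)))
     (Asg 0 (Bin Add (Var 0) (pow_exp (Var 4) s)))"

definition stage_com :: "nat \<Rightarrow> nat \<Rightarrow> com" where
  "stage_com t s = For 11 (pow_exp (Var 6) s) (If (test_exp t s) (hit_com t s) Nop)"

definition estimate_com :: "nat \<Rightarrow> com" where
  "estimate_com t = Then (Asg 0 (Num 0))
     (Then (For 10 (Var 6) (Put (Adr t (Var 10) 1) (Num 0))) (unroll t (\<lambda>s. stage_com t (Suc s))))"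

definition bump_com :: "nat \<Rightarrow> binop \<Rightarrow> nat \<Rightarrow> com" where
  "bump_com t f j = unroll (2 * t + 1) (\<lambda>k.
     Put (Adr t (Var 10) (2 + k)) (Bin f (At (Adr t (Var 10) (2 + k))) (pow_exp (Var j) k)))"

definition edge_com :: "nat \<Rightarrow> binop \<Rightarrow> com" where
  "edge_com t f = For 10 (Var 6) (Then
     (If (Bin Eq (At (Adr t (Var 10) 0)) (Var 1)) (bump_com t f 2) Nop)
     (If (Bin Eq (At (Adr t (Var 10) 0)) (Var 2)) (bump_com t f 1) Nop))"

definition update_com :: "nat \<Rightarrow> com" where
  "update_com t = Then (If (Var 0) (edge_com t Add) (edge_com t Sub)) (estimate_com t)"

lemma digit_less: "0 < r \<Longrightarrow> digit c r l < r"
  by (simp add: digit_def)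

text \<open>Horner's scheme: \<open>f 0\<close> is the lowest digit, and the induction hypothesis
  supplies a number with the remaining digits.\<close>

lemma digits_surj:
  assumes "\<And>l. l < s \<Longrightarrow> f l < r"
  shows "\<exists>c<r ^ s. \<forall>l<s. digit c r l = f l"
  using assms
proof (induction s arbitrary: f)
  case 0
  then show ?case by simp
next
  case (Suc s)
  then have "\<exists>c<r ^ s. \<forall>l<s. digit c r l = f (Suc l)" by simp
  then obtain c where c: "c < r ^ s" "\<And>l. l < s \<Longrightarrow> digit c r l = f (Suc l)" by blast
  have f0: "f 0 < r" using Suc.prems by simp
  have "f 0 + r * c < r * Suc c" using f0 by simp
  also have "\<dots> \<le> r * r ^ s" using c by (intro mult_left_mono) auto
  finally have "f 0 + r * c < r ^ Suc s" by simp
  moreover have "digit (f 0 + r * c) r l = f l" if "l < Suc s" for l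
  proof (cases l)
    case 0
    then show ?thesis using f0 by (simp add: digit_def)
  next
    case (Suc l')
    have "(f 0 + r * c) div r = c" using f0 by simp
    then have "digit (f 0 + r * c) r l = digit c r l'"
      by (simp add: digit_def Suc div_mult2_eq)
    then show ?thesis using c(2) that Suc by simp
  qed
  ultimately show ?case by blast
qed

definition psum :: "nat set set \<Rightarrow> nat \<Rightarrow> nat \<Rightarrow> nat" where
  "psum E u k = (\<Sum>v\<in>nbrs E u. v ^ k)"

text \<open>\<open>word_big\<close> bounds the certificate: at most \<open>t\<close> members, at
  most \<open>n\<close> neighbours each, and products of at most \<open>t\<close> squares bounded by
  \<open>n ^ 2\<close>. \<open>word_big_est\<close> bounds the estimate: at most \<open>n\<close>
  components of weight at most \<open>P ^ t\<close>.\<close>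

locale alg = ram w b N for w b N +
  fixes t n P :: nat
  assumes t_pos: "1 \<le> t" and n_pos: "1 \<le> n" and P_pos: "1 \<le> P"
    and word_big: "t * (n * n ^ (2 * t)) < 2 ^ w"
    and word_big_est: "n * P ^ t < 2 ^ w"
begin

text \<open>The stride \<open>2 * t + 3\<close> consists of a name, a mark and
  \<open>2 * t + 1\<close> power sums.\<close>

definition ad :: "nat \<Rightarrow> nat \<Rightarrow> nat" where
  "ad i k = b + i * (2 * t + 3) + k"

lemma ad_eq [simp]:
  assumes "k < 2 * t + 3" "k' < 2 * t + 3"
  shows "ad i k = ad i' k' \<longleftrightarrow> i = i' \<and> k = k'"
proof
  assume "ad i k = ad i' k'"
  then have "i * (2 * t + 3) + k = i' * (2 * t + 3) + k'" by (simp add: ad_def)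
  then have "(i * (2 * t + 3) + k) div (2 * t + 3) = (i' * (2 * t + 3) + k') div (2 * t + 3)"
    "(i * (2 * t + 3) + k) mod (2 * t + 3) = (i' * (2 * t + 3) + k') mod (2 * t + 3)" by simp_all
  then show "i = i' \<and> k = k'"
    using assms by (simp only: div_mult_self3 mod_mult_self3) simp
qed simp

lemma ad_neq_var [simp]: "j < 16 \<Longrightarrow> ad i k \<noteq> j" "j < 16 \<Longrightarrow> j \<noteq> ad i k"
  using b_ge by (auto simp: ad_def)

definition valid :: "nat list \<Rightarrow> bool" where
  "valid L \<longleftrightarrow> distinct L \<and> set L \<subseteq> {1..n} \<and> ad (length L) 0 \<le> N"

lemma valid_length: "valid L \<Longrightarrow> length L \<le> n"
  using card_mono[of "{1..n}" "set L"] by (auto simp: valid_def distinct_card)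

lemma ad_less:
  assumes "valid L" "i < length L" "k < 2 * t + 3"
  shows "ad i k < N"
proof -
  have "Suc i * (2 * t + 3) \<le> length L * (2 * t + 3)" using assms by (intro mult_right_mono) auto
  then show ?thesis using assms by (simp add: valid_def ad_def)
qed

lemma in_mem_ad:
  assumes "valid L" "i < length L" "k < 2 * t + 3"
  shows "in_mem (ad i k)"
  using ad_less[OF assms] by (simp add: in_mem_def ad_def)

lemma eval_Adr:
  assumes "valid L" "eval \<sigma> e < length L" "k < 2 * t + 3"
  shows "eval \<sigma> (Adr t e k) = ad (eval \<sigma> e) k"
proof -
  have "eval \<sigma> (Adr t e k) = ad (eval \<sigma> e) k mod 2 ^ w"
    by (simp add: Adr_def ad_def mod_simps)
  then show ?thesis using ad_less[OF assms] N_le by simp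
qed

lemma safe_Adr [simp]: "safe \<sigma> (Adr t e k) = safe \<sigma> e"
  by (simp add: Adr_def)

lemma n_pow_less: "k \<le> 2 * t \<Longrightarrow> n * n ^ k < 2 ^ w"
proof -
  assume "k \<le> 2 * t"
  then have "1 * (n * n ^ k) \<le> t * (n * n ^ (2 * t))"
    using t_pos n_pos by (intro mult_mono power_increasing) auto
  then show ?thesis using word_big by (metis le_less_trans mult_1)
qed

lemma n_pow_less': "k \<le> 2 * t \<Longrightarrow> m \<le> n \<Longrightarrow> m ^ k < 2 ^ w"
proof -
  assume "k \<le> 2 * t" "m \<le> n"
  then have "m ^ k \<le> 1 * n ^ k" by (simp add: power_mono)
  also have "\<dots> \<le> n * n ^ k" using n_pos by (intro mult_right_mono) auto
  finally show ?thesis using n_pow_less \<open>k \<le> 2 * t\<close> by (meson le_less_trans)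
qed

lemma n_less: "n < 2 ^ w"
  using n_pow_less[of 0] by simp

lemma t_less: "t < 2 ^ w"
proof -
  have "t * 1 \<le> t * (n * n ^ (2 * t))" using n_pos by (intro mult_left_mono) auto
  then show ?thesis using word_big by (metis le_less_trans mult_1_right)
qed

lemma P_pow_less: "s \<le> t \<Longrightarrow> P ^ s < 2 ^ w"
proof -
  assume "s \<le> t"
  then have "1 * P ^ s \<le> n * P ^ t" using n_pos P_pos by (intro mult_mono power_increasing) auto
  then show ?thesis using word_big_est by simp
qed

lemma psum_less:
  assumes "graph_on n E" "k \<le> 2 * t"
  shows "psum E u k < 2 ^ w"
proof -
  have "psum E u k \<le> (\<Sum>v\<in>nbrs E u. n ^ k)"
    unfolding psum_def using nbrs_subset[OF assms(1), of u] by (intro sum_mono power_mono) auto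
  also have "\<dots> = card (nbrs E u) * n ^ k" by simp
  also have "\<dots> \<le> n * n ^ k"
    using card_mono[OF _ nbrs_subset[OF assms(1)]] by (intro mult_right_mono) auto
  finally show ?thesis using n_pow_less assms(2) by (meson le_less_trans)
qed

text \<open>The input cells and the marks are left free: they are overwritten by each update and by
  each recomputation of the estimate.\<close>

definition st :: "nat set set \<Rightarrow> nat list \<Rightarrow> (nat \<Rightarrow> nat) \<Rightarrow> bool" where
  "st E L \<sigma> \<longleftrightarrow> \<sigma> 4 = P \<and> \<sigma> 6 = length L \<and>
     (\<forall>i<length L. \<sigma> (ad i 0) = L ! i \<and> (\<forall>k\<le>2 * t. \<sigma> (ad i (2 + k)) = psum E (L ! i) k))"

subsection \<open>Maintaining the power sums\<close>

lemma wp_bump_com: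
  assumes L: "valid L" and i: "\<sigma> 10 < length L" and j: "j < 16"
    and Q: "\<And>\<sigma>'. (\<And>a. (\<forall>k\<le>2 * t. a \<noteq> ad (\<sigma> 10) (2 + k)) \<Longrightarrow> \<sigma>' a = \<sigma> a) \<Longrightarrow>
      (\<And>k. k \<le> 2 * t \<Longrightarrow> \<sigma>' (ad (\<sigma> 10) (2 + k)) =
        binop_word w f (\<sigma> (ad (\<sigma> 10) (2 + k))) (\<sigma> j ^ k mod 2 ^ w)) \<Longrightarrow> Q \<sigma>'"
  shows "wp (bump_com t f j) Q \<sigma>"
proof -
  let ?i = "\<sigma> 10"
  define I where "I m \<sigma>' \<longleftrightarrow>
    (\<forall>a. (\<forall>k<m. a \<noteq> ad ?i (2 + k)) \<longrightarrow> \<sigma>' a = \<sigma> a) \<and>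
    (\<forall>k<m. \<sigma>' (ad ?i (2 + k)) = binop_word w f (\<sigma> (ad ?i (2 + k))) (\<sigma> j ^ k mod 2 ^ w))"
    for m \<sigma>'
  have "wp (bump_com t f j) (I (2 * t + 1)) \<sigma>"
    unfolding bump_com_def
  proof (rule wp_unroll)
    show "I 0 \<sigma>" by (simp add: I_def)
  next
    fix k \<sigma>' assume k: "k < 2 * t + 1" and I: "I k \<sigma>'"
    have vars: "\<sigma>' 10 = ?i" "\<sigma>' j = \<sigma> j" using I j by (auto simp: I_def)
    have e: "eval \<sigma>' (Adr t (Var 10) (2 + k)) = ad ?i (2 + k)"
      using eval_Adr[OF L, of \<sigma>' "Var 10" "2 + k"] i k vars by simp
    have old: "\<sigma>' (ad ?i (2 + k)) = \<sigma> (ad ?i (2 + k))" using I k by (simp add: I_def)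
    have m: "in_mem (ad ?i (2 + k))" using in_mem_ad[OF L i] k by simp
    show "wp (Put (Adr t (Var 10) (2 + k))
        (Bin f (At (Adr t (Var 10) (2 + k))) (pow_exp (Var j) k))) (I (Suc k)) \<sigma>'"
    proof (rule wp_Put)
      show "I (Suc k) (\<sigma>'(eval \<sigma>' (Adr t (Var 10) (2 + k)) :=
          eval \<sigma>' (Bin f (At (Adr t (Var 10) (2 + k))) (pow_exp (Var j) k))))"
        using I k j unfolding I_def e eval.simps eval_pow_exp old
        by (auto simp: less_Suc_eq vars)
    qed (use e m j in \<open>auto simp: eval_pow_exp\<close>)
  qed
  then show ?thesis
    by (rule wp_mono) (rule Q; auto simp: I_def less_Suc_eq_le)
qed

lemma wp_edge_com:
  assumes L: "valid L" and st: "st E L \<sigma>" and uv: "\<sigma> 1 \<noteq> \<sigma> 2"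
    and u: "\<And>k. k \<le> 2 * t \<Longrightarrow> psum E' (\<sigma> 1) k = binop_word w f (psum E (\<sigma> 1) k) (\<sigma> 2 ^ k mod 2 ^ w)"
    and v: "\<And>k. k \<le> 2 * t \<Longrightarrow> psum E' (\<sigma> 2) k = binop_word w f (psum E (\<sigma> 2) k) (\<sigma> 1 ^ k mod 2 ^ w)"
    and other: "\<And>x k. x \<noteq> \<sigma> 1 \<Longrightarrow> x \<noteq> \<sigma> 2 \<Longrightarrow> psum E' x k = psum E x k"
  shows "wp (edge_com t f) (st E' L) \<sigma>"
proof -
  \<comment> \<open>Records below \<open>m\<close> already describe \<open>E'\<close>, the others
    still \<open>E\<close>.\<close>
  define I where "I m \<sigma>' \<longleftrightarrow> \<sigma>' 4 = P \<and> \<sigma>' 6 = length L \<and> \<sigma>' 1 = \<sigma> 1 \<and> \<sigma>' 2 = \<sigma> 2 \<and>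
    (\<forall>i<length L. \<sigma>' (ad i 0) = L ! i \<and>
      (\<forall>k\<le>2 * t. \<sigma>' (ad i (2 + k)) = psum (if i < m then E' else E) (L ! i) k))" for m \<sigma>'
  show ?thesis
    unfolding edge_com_def
  proof (rule wp_For[where I = I and M = "length L"])
    show "length L < 2 ^ w" using valid_length[OF L] n_less by simp
    show "I 0 (\<sigma>(10 := 0))" using st by (auto simp: I_def st_def)
    show "st E' L \<sigma>'" if "I (length L) \<sigma>'" for \<sigma>' using that by (auto simp: I_def st_def)
    show "safe \<sigma>' (Var 6) \<and> eval \<sigma>' (Var 6) = length L" if "I k \<sigma>'" for k \<sigma>'
      using that by (auto simp: I_def)
  next
    fix i \<sigma>' assume i: "i < length L" "\<sigma>' 10 = i" and I: "I i \<sigma>'"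
    let ?Q = "\<lambda>\<sigma>''. \<sigma>'' 10 = i \<and> I (Suc i) (\<sigma>''(10 := Suc i))"
    \<comment> \<open>Between the two tests record \<open>i\<close> is up to date exactly if it
      belongs to the first endpoint. The endpoints differ, so no record is changed twice.\<close>
    let ?Q1 = "\<lambda>\<sigma>''. \<sigma>'' 10 = i \<and> (if L ! i = \<sigma> 1 then I (Suc i) \<sigma>'' else I i \<sigma>'')"
    have rd: "safe \<tau> (At (Adr t (Var 10) 0))" "eval \<tau> (At (Adr t (Var 10) 0)) = L ! i"
      if "\<tau> 10 = i" "I i \<tau> \<or> I (Suc i) \<tau>" for \<tau>
      using eval_Adr[OF L, of \<tau> "Var 10" 0] in_mem_ad[OF L i(1), of 0] i that by (auto simp: I_def)
    have bump: "I (Suc i) \<rho>" if \<tau>: "\<tau> 10 = i" "I i \<tau>"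
      and same: "\<And>a. (\<forall>k\<le>2 * t. a \<noteq> ad i (2 + k)) \<Longrightarrow> \<rho> a = \<tau> a"
      and new: "\<And>k. k \<le> 2 * t \<Longrightarrow> \<rho> (ad i (2 + k)) = psum E' (L ! i) k" for \<tau> \<rho>
    proof -
      have "\<rho> (ad i' (2 + k)) = \<tau> (ad i' (2 + k))" if "i' \<noteq> i" "k \<le> 2 * t" for i' k
        by (rule same) (use that in auto)
      moreover have "\<rho> (ad i' 0) = \<tau> (ad i' 0)" for i'
        by (rule same) auto
      moreover have "\<rho> j = \<tau> j" if "j < 16" for j
        by (rule same) (use that in auto)
      ultimately show ?thesis
        using \<tau>(2) new unfolding I_def by (auto simp: less_Suc_eq)
    qed
    have skip: "I (Suc i) \<tau>" if "I i \<tau>" "L ! i \<noteq> \<sigma> 1" "L ! i \<noteq> \<sigma> 2" for \<tau>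
      using that other by (auto simp: I_def less_Suc_eq)
    have "wp (If (Bin Eq (At (Adr t (Var 10) 0)) (Var 1)) (bump_com t f 2) Nop) ?Q1 \<sigma>'"
    proof (rule wp_If)
      show "safe \<sigma>' (Bin Eq (At (Adr t (Var 10) 0)) (Var 1))" using rd[of \<sigma>'] i I by simp
      assume "eval \<sigma>' (Bin Eq (At (Adr t (Var 10) 0)) (Var 1)) \<noteq> 0"
      then have eq: "L ! i = \<sigma> 1" using rd[of \<sigma>'] i I by (auto simp: I_def split: if_splits)
      show "wp (bump_com t f 2) ?Q1 \<sigma>'"
      proof (rule wp_bump_com[OF L])
        fix \<rho> assume same: "\<And>a. (\<forall>k\<le>2 * t. a \<noteq> ad (\<sigma>' 10) (2 + k)) \<Longrightarrow> \<rho> a = \<sigma>' a"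
          and new: "\<And>k. k \<le> 2 * t \<Longrightarrow> \<rho> (ad (\<sigma>' 10) (2 + k)) =
            binop_word w f (\<sigma>' (ad (\<sigma>' 10) (2 + k))) (\<sigma>' 2 ^ k mod 2 ^ w)"
        have "I (Suc i) \<rho>"
          by (rule bump[OF i(2) I]) (use same new i I u eq in \<open>auto simp: I_def\<close>)
        moreover have "\<rho> 10 = i" using same[of 10] i by simp
        ultimately show "?Q1 \<rho>" using eq by simp
      qed (use i in auto)
    next
      assume "eval \<sigma>' (Bin Eq (At (Adr t (Var 10) 0)) (Var 1)) = 0"
      then have "L ! i \<noteq> \<sigma> 1" using rd[of \<sigma>'] i I by (auto simp: I_def split: if_splits)
      then show "wp Nop ?Q1 \<sigma>'" using i I by (simp add: wp_Nop)
    qed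
    moreover have "wp (If (Bin Eq (At (Adr t (Var 10) 0)) (Var 2)) (bump_com t f 1) Nop) ?Q \<tau>"
      if \<tau>: "?Q1 \<tau>" for \<tau>
    proof -
      have Iup: "?Q \<rho>" if "\<rho> 10 = i" "I (Suc i) \<rho>" for \<rho> using that by (auto simp: I_def)
      have or: "\<tau> 10 = i" "I i \<tau> \<or> I (Suc i) \<tau>" using \<tau> by (auto split: if_splits)
      have v2: "\<tau> 2 = \<sigma> 2" "\<tau> 1 = \<sigma> 1" using or by (auto simp: I_def)
      show ?thesis
      proof (rule wp_If)
        show "safe \<tau> (Bin Eq (At (Adr t (Var 10) 0)) (Var 2))" using rd[OF or] by simp
        assume "eval \<tau> (Bin Eq (At (Adr t (Var 10) 0)) (Var 2)) \<noteq> 0"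
        then have eq: "L ! i = \<sigma> 2" using rd[OF or] v2 by (auto split: if_splits)
        then have I': "I i \<tau>" using \<tau> uv by simp
        show "wp (bump_com t f 1) ?Q \<tau>"
        proof (rule wp_bump_com[OF L])
          fix \<rho> assume same: "\<And>a. (\<forall>k\<le>2 * t. a \<noteq> ad (\<tau> 10) (2 + k)) \<Longrightarrow> \<rho> a = \<tau> a"
            and new: "\<And>k. k \<le> 2 * t \<Longrightarrow> \<rho> (ad (\<tau> 10) (2 + k)) =
              binop_word w f (\<tau> (ad (\<tau> 10) (2 + k))) (\<tau> 1 ^ k mod 2 ^ w)"
          have "I (Suc i) \<rho>"
            by (rule bump[OF or(1) I']) (use same new i I' v eq v2 or in \<open>auto simp: I_def\<close>)
          moreover have "\<rho> 10 = i" using same[of 10] or by simp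
          ultimately show "?Q \<rho>" using Iup by blast
        qed (use i or in auto)
      next
        assume "eval \<tau> (Bin Eq (At (Adr t (Var 10) 0)) (Var 2)) = 0"
        then have "L ! i \<noteq> \<sigma> 2" using rd[OF or] v2 by (auto split: if_splits)
        then have "I (Suc i) \<tau>" using \<tau> skip by (auto split: if_splits)
        then show "wp Nop ?Q \<tau>" using Iup or by (intro wp_Nop) blast
      qed
    qed
    ultimately show "wp (Then (If (Bin Eq (At (Adr t (Var 10) 0)) (Var 1)) (bump_com t f 2) Nop)
       (If (Bin Eq (At (Adr t (Var 10) 0)) (Var 2)) (bump_com t f 1) Nop)) ?Q \<sigma>'"
      by (intro wp_Then) (rule wp_mono)
  qed simp
qed

lemma nbrs_Insert:
  "nbrs (apply_update E (Insert u v)) x =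
     (if x = u then insert v (nbrs E u) else {}) \<union> (if x = v then insert u (nbrs E v) else {}) \<union> nbrs E x"
  by (auto simp: nbrs_def doubleton_eq_iff)

lemma nbrs_Delete:
  "nbrs (apply_update E (Delete u v)) x =
     nbrs E x - (if x = u then {v} else {}) - (if x = v then {u} else {})"
  by (auto simp: nbrs_def doubleton_eq_iff)

text \<open>Legality makes \<open>v\<close> a new neighbour, so the sum grows by
  \<open>v ^ k\<close>; the new sum is below \<open>2 ^ w\<close>, so reduction modulo
  \<open>2 ^ w\<close> leaves it unchanged.\<close>

lemma psum_Insert:
  assumes "graph_on n E" "legal_update n E (Insert u v)" "k \<le> 2 * t"
  shows "psum (apply_update E (Insert u v)) u k = binop_word w Add (psum E u k) (v ^ k mod 2 ^ w)"
proof -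
  have v: "v \<notin> nbrs E u" "u \<noteq> v" using assms by (auto simp: nbrs_def)
  then have "nbrs (apply_update E (Insert u v)) u = insert v (nbrs E u)"
    unfolding nbrs_Insert by auto
  then have "psum (apply_update E (Insert u v)) u k = psum E u k + v ^ k"
    using finite_nbrs[OF assms(1)] v by (simp add: psum_def)
  then show ?thesis
    using psum_less[OF graph_on_apply_update[OF assms(1,2)] assms(3), of u] by simp
qed

lemma psum_Delete:
  assumes "graph_on n E" "legal_update n E (Delete u v)" "k \<le> 2 * t"
  shows "psum (apply_update E (Delete u v)) u k = binop_word w Sub (psum E u k) (v ^ k mod 2 ^ w)"
proof -
  have v: "v \<in> nbrs E u" "u \<noteq> v" using assms graph_on_edge[OF assms(1)] by (auto simp: nbrs_def)
  then have "nbrs (apply_update E (Delete u v)) u = nbrs E u - {v}"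
    unfolding nbrs_Delete by auto
  then have "psum E u k = psum (apply_update E (Delete u v)) u k + v ^ k"
    using sum.remove[OF finite_nbrs[OF assms(1)] v(1), of "\<lambda>x. x ^ k"] by (simp add: psum_def)
  then show ?thesis
    using psum_less[OF assms(1,3), of u] by simp
qed

lemma legal_update_swap:
  "legal_update n E (Insert u v) = legal_update n E (Insert v u)"
  "legal_update n E (Delete u v) = legal_update n E (Delete v u)"
  "apply_update E (Insert u v) = apply_update E (Insert v u)"
  "apply_update E (Delete u v) = apply_update E (Delete v u)"
  by (auto simp: insert_commute)

lemma wp_edges:
  assumes L: "valid L" and st: "st E L \<sigma>" and E: "graph_on n E" and x: "legal_update n E x"
    and \<sigma>: "\<sigma> 0 = (case x of Insert _ _ \<Rightarrow> 1 | Delete _ _ \<Rightarrow> 0)"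
      "\<sigma> 1 = (case x of Insert u v \<Rightarrow> u | Delete u v \<Rightarrow> u)"
      "\<sigma> 2 = (case x of Insert u v \<Rightarrow> v | Delete u v \<Rightarrow> v)"
  shows "wp (If (Var 0) (edge_com t Add) (edge_com t Sub)) (st (apply_update E x) L) \<sigma>"
proof (cases x)
  case (Insert u v)
  have "wp (edge_com t Add) (st (apply_update E x) L) \<sigma>"
  proof (rule wp_edge_com[OF L st])
    show "\<sigma> 1 \<noteq> \<sigma> 2" using x \<sigma> Insert by simp
    show "psum (apply_update E x) y k = psum E y k" if "y \<noteq> \<sigma> 1" "y \<noteq> \<sigma> 2" for y k
      using that \<sigma> by (simp only: Insert psum_def nbrs_Insert) simp
    show "psum (apply_update E x) (\<sigma> 1) k = binop_word w Add (psum E (\<sigma> 1) k) (\<sigma> 2 ^ k mod 2 ^ w)"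
      if "k \<le> 2 * t" for k
      using psum_Insert[OF E _ that, of u v] x \<sigma> unfolding Insert by simp
    show "psum (apply_update E x) (\<sigma> 2) k = binop_word w Add (psum E (\<sigma> 2) k) (\<sigma> 1 ^ k mod 2 ^ w)"
      if "k \<le> 2 * t" for k
      using psum_Insert[OF E _ that, of v u] x \<sigma>
      unfolding Insert legal_update_swap(1)[of _ u] legal_update_swap(3)[of _ u] by simp
  qed
  then show ?thesis using \<sigma> Insert by (intro wp_If) auto
next
  case (Delete u v)
  have "wp (edge_com t Sub) (st (apply_update E x) L) \<sigma>"
  proof (rule wp_edge_com[OF L st])
    show "\<sigma> 1 \<noteq> \<sigma> 2" using x \<sigma> Delete graph_on_edge[OF E] by simp
    show "psum (apply_update E x) y k = psum E y k" if "y \<noteq> \<sigma> 1" "y \<noteq> \<sigma> 2" for y k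
      using that \<sigma> by (simp only: Delete psum_def nbrs_Delete) simp
    show "psum (apply_update E x) (\<sigma> 1) k = binop_word w Sub (psum E (\<sigma> 1) k) (\<sigma> 2 ^ k mod 2 ^ w)"
      if "k \<le> 2 * t" for k
      using psum_Delete[OF E _ that, of u v] x \<sigma> unfolding Delete by simp
    show "psum (apply_update E x) (\<sigma> 2) k = binop_word w Sub (psum E (\<sigma> 2) k) (\<sigma> 1 ^ k mod 2 ^ w)"
      if "k \<le> 2 * t" for k
      using psum_Delete[OF E _ that, of v u] x \<sigma>
      unfolding Delete legal_update_swap(2)[of _ u] legal_update_swap(4)[of _ u] by simp
  qed
  then show ?thesis using \<sigma> Delete by (intro wp_If) auto
qed

section \<open>Exhaustive search for components among tuples of records\<close>

subsection \<open>Recomputing the estimate\<close>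

lemma eval_digit_exp:
  assumes "valid L" "\<sigma> 6 = length L" "l \<le> t"
  shows "eval \<sigma> (digit_exp l) = digit (\<sigma> 11) (length L) l"
  using n_pow_less'[of l "length L"] valid_length[OF assms(1)] assms
  by (simp add: digit_exp_def digit_def eval_pow_exp)

lemma safe_digit_exp: "safe \<sigma> (digit_exp l)"
  by (simp add: digit_exp_def)

lemma field_exp:
  assumes "valid L" "\<sigma> 6 = length L" "l \<le> t" "0 < length L" "k < 2 * t + 3"
  shows "safe \<sigma> (field_exp t k l)"
    "eval \<sigma> (field_exp t k l) = \<sigma> (ad (digit (\<sigma> 11) (length L) l) k)"
  using eval_digit_exp[where \<sigma> = \<sigma>, OF assms(1-3)] digit_less[OF assms(4)] eval_Adr[OF assms(1) _ assms(5)]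
    in_mem_ad[OF assms(1) _ assms(5)] by (auto simp: field_exp_def safe_digit_exp)

text \<open>The word agrees modulo \<open>2 ^ w\<close> with the integer certificate, and both lie
  between \<open>0\<close> and \<open>2 ^ w - 1\<close>; so they are equal, whatever wrapped on the
  way.\<close>

lemma closed_exp:
  assumes L: "valid L" and st: "st E L \<sigma>" and E: "graph_on n E" and s: "1 \<le> s" "s \<le> t"
    and c: "0 < length L" and x: "\<And>l. x l = L ! digit (\<sigma> 11) (length L) l"
  shows "safe \<sigma> (closed_exp t s)"
    and "eval \<sigma> (closed_exp t s) = 0 \<longleftrightarrow> closed_set E (x ` {..<s})"
proof -
  have r: "\<sigma> 6 = length L" using st by (simp add: st_def)
  note f = field_exp[where \<sigma> = \<sigma>, OF L r _ c]
  have dig: "digit (\<sigma> 11) (length L) l < length L" for l using digit_less[OF c] .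
  have x_le: "x l \<le> n" for l
  proof -
    have "x l \<in> {1..n}" using L nth_mem[OF dig[of l]] unfolding x valid_def by blast
    then show ?thesis by simp
  qed
  show "safe \<sigma> (closed_exp t s)"
    unfolding closed_exp_def
    by (rule safe_moment_exp) (use f(1) s in \<open>auto intro!: safe_sum_exp\<close>)
  \<comment> \<open>The measure counts pairs of a position \<open>l\<close> and a neighbour of
    \<open>x l\<close>; repeated vertices in the tuple count repeatedly, which does not affect
    vanishing.\<close>
  define A :: "(int \<Rightarrow> int) \<Rightarrow> int" where "A g = (\<Sum>l<s. \<Sum>v\<in>nbrs E (x l). g (int v))" for g
  define V where "V = A (\<lambda>v. \<Prod>i<s. (v - int (x i))\<^sup>2)"
  let ?ys = "map (field_exp t 0) ([0..<s] @ [0..<s])"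
  have "int (eval \<sigma> (closed_exp t s)) mod 2 ^ w =
      A (\<lambda>v. v ^ 0 * (\<Prod>y\<leftarrow>?ys. v - int (eval \<sigma> y))) mod 2 ^ w"
    unfolding closed_exp_def
  proof (rule eval_moment_exp)
    show "A (\<lambda>v. f v - y * g v) = A f - y * A g" for f g y
      by (simp add: A_def sum_subtractf sum_distrib_left)
    fix j assume "j \<le> 0 + length ?ys"
    then have j: "j \<le> 2 * t" using s by simp
    have "eval \<sigma> (sum_exp s (field_exp t (2 + j))) = (\<Sum>l<s. psum E (x l) j) mod 2 ^ w"
      unfolding eval_sum_exp using f(2) s j st dig x
      by (intro arg_cong[where f = "\<lambda>y. y mod 2 ^ w"] sum.cong refl) (simp add: st_def)
    then show "int (eval \<sigma> (sum_exp s (field_exp t (2 + j)))) mod 2 ^ w = A (\<lambda>v. v ^ j) mod 2 ^ w"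
      by (simp add: A_def psum_def zmod_int)
  qed
  also have "(\<lambda>v. v ^ 0 * (\<Prod>y\<leftarrow>?ys. v - int (eval \<sigma> y))) = (\<lambda>v. \<Prod>i<s. (v - int (x i))\<^sup>2)"
  proof
    fix v
    have "(\<Prod>y\<leftarrow>map (field_exp t 0) [0..<s]. v - int (eval \<sigma> y)) =
        (\<Prod>i\<in>set [0..<s]. v - int (eval \<sigma> (field_exp t 0 i)))"
      by (subst prod.distinct_set_conv_list) (simp_all add: o_def)
    also have "\<dots> = (\<Prod>i<s. v - int (x i))"
      using f(2) s st dig x by (intro prod.cong) (auto simp: st_def)
    finally show "v ^ 0 * (\<Prod>y\<leftarrow>?ys. v - int (eval \<sigma> y)) = (\<Prod>i<s. (v - int (x i))\<^sup>2)"
      by (simp add: power2_eq_square prod.distrib)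
  qed
  finally have cong: "int (eval \<sigma> (closed_exp t s)) mod 2 ^ w = V mod 2 ^ w"
    by (simp add: V_def)
  \<comment> \<open>As \<open>1 \<le> s\<close>, the outermost operation is a word subtraction,
    which reduces modulo \<open>2 ^ w\<close>.\<close>
  have "eval \<sigma> (closed_exp t s) < 2 ^ w"
    using s by (cases s) (auto simp: closed_exp_def upt_conv_Cons simp del: upt_Suc)
  then have "int (eval \<sigma> (closed_exp t s)) < 2 ^ w" by (metis of_nat_less_iff of_nat_numeral of_nat_power)
  then have e: "int (eval \<sigma> (closed_exp t s)) mod 2 ^ w = int (eval \<sigma> (closed_exp t s))" by simp
  have "0 \<le> V" unfolding V_def A_def by (intro sum_nonneg prod_nonneg) auto
  moreover have "V < 2 ^ w"
  proof -
    have "(\<Prod>i<s. (int v - int (x i))\<^sup>2) \<le> int (n ^ (2 * t))" if "v \<in> nbrs E (x l)" for l v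
    proof -
      have v: "v \<le> n" using that nbrs_subset[OF E, of "x l"] by auto
      have "(int v - int (x i))\<^sup>2 \<le> (int n)\<^sup>2" for i
        using v x_le[of i] by (intro power2_le_iff_abs_le[THEN iffD2]) auto
      then have "(\<Prod>i<s. (int v - int (x i))\<^sup>2) \<le> (\<Prod>i<s. (int n)\<^sup>2)" by (intro prod_mono) auto
      also have "\<dots> = int n ^ (2 * s)" by (simp add: power_mult)
      also have "\<dots> \<le> int n ^ (2 * t)" using s n_pos by (intro power_increasing) auto
      finally show ?thesis by simp
    qed
    then have "V \<le> (\<Sum>l<s. \<Sum>v\<in>nbrs E (x l). int (n ^ (2 * t)))"
      unfolding V_def A_def by (intro sum_mono) blast
    also have "\<dots> = (\<Sum>l<s. int (card (nbrs E (x l)) * n ^ (2 * t)))" by simp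
    also have "\<dots> \<le> (\<Sum>l<s. int (n * n ^ (2 * t)))"
      using card_mono[OF _ nbrs_subset[OF E]]
      by (intro sum_mono of_nat_mono mult_right_mono) auto
    also have "\<dots> = int (s * (n * n ^ (2 * t)))" by simp
    also have "\<dots> \<le> int (t * (n * n ^ (2 * t)))" using s by (intro of_nat_mono mult_right_mono) auto
    also have "\<dots> < 2 ^ w" using word_big by (metis of_nat_less_iff of_nat_numeral of_nat_power)
    finally show ?thesis .
  qed
  ultimately have "int (eval \<sigma> (closed_exp t s)) = V" using cong e by simp
  then have "eval \<sigma> (closed_exp t s) = 0 \<longleftrightarrow> V = 0" by auto
  also have "\<dots> \<longleftrightarrow> closed_set E (x ` {..<s})"
    by (simp add: closed_set_iff_sum[OF E] V_def A_def)
  finally show "eval \<sigma> (closed_exp t s) = 0 \<longleftrightarrow> closed_set E (x ` {..<s})" .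
qed

definition marks :: "nat list \<Rightarrow> nat set \<Rightarrow> (nat \<Rightarrow> nat) \<Rightarrow> bool" where
  "marks L M \<sigma> \<longleftrightarrow> (\<forall>i<length L. \<sigma> (ad i 1) = of_bool (L ! i \<in> M))"

lemma test_exp:
  assumes L: "valid L" and st: "st E L \<sigma>" and E: "graph_on n E" and s: "1 \<le> s" "s \<le> t"
    and c: "0 < length L" and x: "\<And>l. x l = L ! digit (\<sigma> 11) (length L) l"
    and M: "marks L M \<sigma>"
  shows "safe \<sigma> (test_exp t s)"
    and "eval \<sigma> (test_exp t s) \<noteq> 0 \<longleftrightarrow> closed_set E (x ` {..<s}) \<and> x ` {..<s} \<inter> M = {}"
proof -
  have r: "\<sigma> 6 = length L" using st by (simp add: st_def)
  note f = field_exp[where \<sigma> = \<sigma>, OF L r _ c] and cl = closed_exp[OF L st E s c x]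
  have dig: "digit (\<sigma> 11) (length L) l < length L" for l using digit_less[OF c] .
  show "safe \<sigma> (test_exp t s)"
    unfolding test_exp_def using cl(1) f(1)[of _ 1] s by (auto intro!: safe_sum_exp)
  have "eval \<sigma> (sum_exp s (field_exp t 1)) = (\<Sum>l<s. of_bool (x l \<in> M)) mod 2 ^ w"
    unfolding eval_sum_exp using f(2)[of _ 1] s M dig x
    by (intro arg_cong[where f = "\<lambda>y. y mod 2 ^ w"] sum.cong refl) (simp add: marks_def)
  also have "\<dots> = (\<Sum>l<s. of_bool (x l \<in> M))"
  proof (rule mod_less)
    have "(\<Sum>l<s. of_bool (x l \<in> M)) \<le> (\<Sum>l<s. 1::nat)" by (intro sum_mono) auto
    then show "(\<Sum>l<s. of_bool (x l \<in> M)) < (2::nat) ^ w" using s t_less by simp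
  qed
  finally have "eval \<sigma> (sum_exp s (field_exp t 1)) = 0 \<longleftrightarrow> x ` {..<s} \<inter> M = {}"
    by (auto simp: of_bool_def)
  with cl(2) show "eval \<sigma> (test_exp t s) \<noteq> 0 \<longleftrightarrow> closed_set E (x ` {..<s}) \<and> x ` {..<s} \<inter> M = {}"
    by (simp add: test_exp_def)
qed

lemma st_upd [simp]:
  "st E L (\<sigma>(ad i 1 := y)) = st E L \<sigma>"
  "st E L (\<sigma>(ad i (Suc 0) := y)) = st E L \<sigma>"
  "j = 0 \<or> j = 10 \<or> j = 11 \<Longrightarrow> st E L (\<sigma>(j := y)) = st E L \<sigma>"
  by (auto simp: st_def)

lemma marks_upd [simp]: "j < 16 \<Longrightarrow> marks L M (\<sigma>(j := y)) = marks L M \<sigma>"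
  by (auto simp: marks_def)

lemma wp_hit_com:
  assumes L: "valid L" and st: "st E L \<sigma>" and s: "s \<le> t" and c: "0 < length L"
    and x: "\<And>l. x l = L ! digit (\<sigma> 11) (length L) l"
    and M: "marks L M \<sigma>" and small: "\<sigma> 0 + P ^ s < 2 ^ w"
    and Q: "\<And>\<sigma>'. st E L \<sigma>' \<Longrightarrow> marks L (M \<union> x ` {..<s}) \<sigma>' \<Longrightarrow> \<sigma>' 0 = \<sigma> 0 + P ^ s \<Longrightarrow>
      \<sigma>' 11 = \<sigma> 11 \<Longrightarrow> Q \<sigma>'"
  shows "wp (hit_com t s) Q \<sigma>"
proof -
  define I where "I m \<sigma>' \<longleftrightarrow> st E L \<sigma>' \<and> marks L (M \<union> x ` {..<m}) \<sigma>' \<and> \<sigma>' 0 = \<sigma> 0 \<and> \<sigma>' 11 = \<sigma> 11"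
    for m \<sigma>'
  have "wp (unroll s (\<lambda>l. Put (Adr t (digit_exp l) 1) (Num 1))) (I s) \<sigma>"
  proof (rule wp_unroll)
    show "I 0 \<sigma>" using st M by (simp add: I_def)
    fix l \<sigma>' assume l: "l < s" and I: "I l \<sigma>'"
    let ?d = "digit (\<sigma> 11) (length L) l"
    have d: "?d < length L" using digit_less[OF c] .
    have "\<sigma>' 6 = length L" using I by (simp add: I_def st_def)
    then have "eval \<sigma>' (digit_exp l) = ?d"
      using eval_digit_exp[OF L, of \<sigma>' l] I l s by (simp add: I_def)
    then have e: "eval \<sigma>' (Adr t (digit_exp l) 1) = ad ?d 1"
      using eval_Adr[OF L, of \<sigma>' "digit_exp l" 1] d by simp
    \<comment> \<open>The sampled names are distinct, so marking a position marks exactly one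
      vertex; a repeated digit only repeats the same write.\<close>
    have dist: "L ! i = x l \<longleftrightarrow> i = ?d" if "i < length L" for i
      unfolding x using L d that by (auto simp: valid_def nth_eq_iff_index_eq)
    have "marks L (M \<union> x ` {..<Suc l}) (\<sigma>'(ad ?d 1 := 1))"
      using I dist by (auto simp: I_def marks_def lessThan_Suc)
    then have "I (Suc l) (\<sigma>'(ad ?d 1 := 1))" using I by (simp add: I_def)
    then show "wp (Put (Adr t (digit_exp l) 1) (Num 1)) (I (Suc l)) \<sigma>'"
      using e in_mem_ad[OF L d, of 1] by (intro wp_Put) (auto simp: safe_digit_exp)
  qed
  then show ?thesis
    unfolding hit_com_def
  proof (rule wp_Then[OF wp_mono])
    fix \<sigma>' assume I: "I s \<sigma>'"
    have P: "\<sigma>' 4 = P" using I by (simp add: I_def st_def)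
    have "eval \<sigma>' (Bin Add (Var 0) (pow_exp (Var 4) s)) = \<sigma> 0 + P ^ s"
      using I P P_pow_less[OF s] small by (simp add: I_def eval_pow_exp)
    moreover have "Q (\<sigma>'(0 := \<sigma> 0 + P ^ s))"
      by (rule Q) (use I in \<open>auto simp: I_def\<close>)
    ultimately show "wp (Asg 0 (Bin Add (Var 0) (pow_exp (Var 4) s))) Q \<sigma>'"
      by (intro wp_Put) auto
  qed
qed

definition found :: "nat set set \<Rightarrow> nat list \<Rightarrow> nat \<Rightarrow> nat set set" where
  "found E L s = {C. C \<in> conn_comps n E \<and> card C \<le> s \<and> C \<subseteq> set L}"

definition tup :: "nat list \<Rightarrow> nat \<Rightarrow> nat \<Rightarrow> nat set" where
  "tup L s c = (\<lambda>l. L ! digit c (length L) l) ` {..<s}"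

lemma finite_found: "finite (found E L s)"
  unfolding found_def using finite_components by (rule rev_finite_subset) auto

text \<open>Any enumeration of \<open>C\<close> yields digits of a counter. A set is met once for
  each of its orderings; the marks prevent it from being counted again.\<close>

lemma tup_surj:
  assumes "C \<subseteq> set L" "card C = s" "finite C"
  shows "\<exists>c<length L ^ s. C = tup L s c"
proof -
  obtain g where g: "bij_betw g {..<s} C"
    using ex_bij_betw_nat_finite[OF assms(3)] assms(2) by (auto simp: atLeast0LessThan)
  have "\<forall>l. \<exists>i. l < s \<longrightarrow> i < length L \<and> L ! i = g l"
    using g assms(1) by (metis bij_betwE in_set_conv_nth lessThan_iff subsetD)
  then obtain f where f: "\<And>l. l < s \<Longrightarrow> f l < length L \<and> L ! f l = g l" by metis
  then obtain c where "c < length L ^ s" "\<forall>l<s. digit c (length L) l = f l"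
    using digits_surj[of s f "length L"] by blast
  moreover from this f have "tup L s c = g ` {..<s}" unfolding tup_def by (intro image_cong) auto
  ultimately show ?thesis using g by (auto simp: bij_betw_def)
qed

lemma est_small:
  assumes "G \<subseteq> found E L t"
  shows "(\<Sum>C\<in>G. P ^ card C) < 2 ^ w"
proof -
  have "(\<Sum>C\<in>G. P ^ card C) \<le> (\<Sum>C\<in>G. P ^ t)"
    using assms P_pos by (intro sum_mono power_increasing) (auto simp: found_def)
  also have "\<dots> = card G * P ^ t" by simp
  also have "\<dots> \<le> n * P ^ t"
  proof -
    have "G \<subseteq> conn_comps n E" using assms by (auto simp: found_def)
    then have "card G \<le> n"
      using card_mono[OF finite_components] card_components_le le_trans by blast
    then show ?thesis by (rule mult_right_mono) simp
  qed
  finally show ?thesis using word_big_est by simp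
qed

definition counted :: "nat set set \<Rightarrow> nat list \<Rightarrow> nat set set \<Rightarrow> (nat \<Rightarrow> nat) \<Rightarrow> bool" where
  "counted E L G \<sigma> \<longleftrightarrow> st E L \<sigma> \<and> marks L (\<Union>G) \<sigma> \<and> \<sigma> 0 = (\<Sum>C\<in>G. P ^ card C)"

lemma counted_upd [simp]: "j = 10 \<or> j = 11 \<Longrightarrow> counted E L G (\<sigma>(j := y)) = counted E L G \<sigma>"
  by (auto simp: counted_def)

text \<open>When the tuples of length \<open>Suc s\<close> are examined, all components of size at most \<open>s\<close> are marked.
  An unmarked closed set is therefore a single component of size \<open>Suc s\<close>.\<close>

lemma wp_stage_com:
  assumes L: "valid L" and E: "graph_on n E" and s: "Suc s \<le> t"
    and \<sigma>: "counted E L (found E L s) \<sigma>"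
  shows "wp (stage_com t (Suc s)) (counted E L (found E L (Suc s))) \<sigma>"
proof -
  let ?r = "length L"
  \<comment> \<open>\<open>G\<close> is the family counted so far: all components of size at most
    \<open>s\<close>, and of the larger ones at least those met at a counter value below
    \<open>c\<close>.\<close>
  define I where "I c \<sigma>' \<longleftrightarrow> (\<exists>G. found E L s \<subseteq> G \<and> G \<subseteq> found E L (Suc s) \<and>
    (\<forall>C\<in>found E L (Suc s). \<forall>c'<c. C = tup L (Suc s) c' \<longrightarrow> C \<in> G) \<and> counted E L G \<sigma>')" for c \<sigma>'
  show ?thesis
    unfolding stage_com_def
  proof (rule wp_For[where I = I and M = "?r ^ Suc s"])
    show r_less: "?r ^ Suc s < 2 ^ w" using s valid_length[OF L] by (intro n_pow_less') auto
    show "I 0 (\<sigma>(11 := 0))"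
      unfolding I_def using \<sigma> by (intro exI[of _ "found E L s"]) (auto simp: found_def)
    show "safe \<sigma>' (pow_exp (Var 6) (Suc s)) \<and> eval \<sigma>' (pow_exp (Var 6) (Suc s)) = ?r ^ Suc s"
      if "I k \<sigma>'" for k \<sigma>'
    proof -
      have "\<sigma>' 6 = ?r" using that by (auto simp: I_def counted_def st_def)
      then have "eval \<sigma>' (pow_exp (Var 6) (Suc s)) = ?r ^ Suc s"
        using r_less unfolding eval_pow_exp by simp
      then show ?thesis by (simp del: pow_exp.simps)
    qed
  next
    fix \<sigma>' assume "I (?r ^ Suc s) \<sigma>'"
    then obtain G where G: "found E L s \<subseteq> G" "G \<subseteq> found E L (Suc s)"
      "\<forall>C\<in>found E L (Suc s). \<forall>c'<?r ^ Suc s. C = tup L (Suc s) c' \<longrightarrow> C \<in> G" "counted E L G \<sigma>'"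
      unfolding I_def by blast
    have "C \<in> G" if C: "C \<in> found E L (Suc s)" for C
    proof (cases "card C \<le> s")
      case True
      then show ?thesis using C G(1) by (auto simp: found_def)
    next
      case False
      then have "\<exists>c<?r ^ Suc s. C = tup L (Suc s) c"
        using C by (intro tup_surj) (auto simp: found_def intro: component_finite)
      then show ?thesis using G(3) C by blast
    qed
    then have "G = found E L (Suc s)" using G(2) by blast
    then show "counted E L (found E L (Suc s)) \<sigma>'" using G(4) by simp
  next
    fix c \<sigma>' assume c: "c < ?r ^ Suc s" "\<sigma>' 11 = c" and "I c \<sigma>'"
    then obtain G where G: "found E L s \<subseteq> G" "G \<subseteq> found E L (Suc s)"
      "\<forall>C\<in>found E L (Suc s). \<forall>c'<c. C = tup L (Suc s) c' \<longrightarrow> C \<in> G" and cnt: "counted E L G \<sigma>'"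
      unfolding I_def by blast
    have st: "st E L \<sigma>'" and mk: "marks L (\<Union>G) \<sigma>'" and \<sigma>0: "\<sigma>' 0 = (\<Sum>C\<in>G. P ^ card C)"
      using cnt by (auto simp: counted_def)
    have r: "0 < ?r" using c by (cases ?r) auto
    define x where "x l = L ! digit (\<sigma>' 11) ?r l" for l
    let ?T = "x ` {..<Suc s}"
    have T: "?T = tup L (Suc s) c" unfolding tup_def x_def c(2) ..
    note test = test_exp[OF L st E _ s r x_def mk]
    let ?Q = "\<lambda>\<sigma>''. \<sigma>'' 11 = c \<and> I (Suc c) (\<sigma>''(11 := Suc c))"
    have T_sub: "?T \<subseteq> set L" using digit_less[OF r] by (auto simp: x_def)
    have G_comp: "C \<in> conn_comps n E" if "C \<in> G" for C using that G(2) by (auto simp: found_def)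
    show "wp (If (test_exp t (Suc s)) (hit_com t (Suc s)) Nop) ?Q \<sigma>'"
    proof (rule wp_If)
      show "safe \<sigma>' (test_exp t (Suc s))" using test(1) by simp
    next
      assume "eval \<sigma>' (test_exp t (Suc s)) \<noteq> 0"
      then have cl: "closed_set E ?T" and un: "?T \<inter> \<Union>G = {}" using test(2) by auto
      have "?T \<in> conn_comps n E \<and> card ?T = Suc s"
      proof (rule closed_set_eq_component[OF cl])
        show "?T \<subseteq> {1..n}" using T_sub L by (auto simp: valid_def)
        show "card ?T \<le> Suc s" using card_image_le[of "{..<Suc s}" x] by simp
        fix C assume C: "C \<in> conn_comps n E" "C \<subseteq> ?T"
        show "Suc s \<le> card C"
        proof (rule ccontr)
          assume "\<not> Suc s \<le> card C"
          then have "C \<in> found E L s" using C subset_trans[OF C(2) T_sub] by (simp add: found_def)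
          then have "C \<in> G" using G(1) by blast
          then show False using un C component_nonempty[of C n E] by blast
        qed
      qed auto
      then have TF: "?T \<in> found E L (Suc s)" and cT: "card ?T = Suc s"
        using T_sub by (auto simp: found_def)
      have "?T \<notin> G" using un by auto
      have "finite G" using finite_subset[OF G(2) finite_found] .
      have sum: "(\<Sum>C\<in>insert ?T G. P ^ card C) = \<sigma>' 0 + P ^ Suc s"
        using \<open>?T \<notin> G\<close> \<open>finite G\<close> \<sigma>0 cT by simp
      have "insert ?T G \<subseteq> found E L t" using TF G(2) s by (auto simp: found_def)
      note small = est_small[OF this]
      show "wp (hit_com t (Suc s)) ?Q \<sigma>'"
      proof (rule wp_hit_com[OF L st s r x_def mk])
        show "\<sigma>' 0 + P ^ Suc s < 2 ^ w" using small sum by simp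
        fix \<sigma>'' assume "st E L \<sigma>''" "marks L (\<Union>G \<union> ?T) \<sigma>''" "\<sigma>'' 0 = \<sigma>' 0 + P ^ Suc s" "\<sigma>'' 11 = \<sigma>' 11"
        then have "counted E L (insert ?T G) \<sigma>''" using sum by (simp add: counted_def Un_commute)
        moreover have "\<forall>C\<in>found E L (Suc s). \<forall>c'<Suc c. C = tup L (Suc s) c' \<longrightarrow> C \<in> insert ?T G"
          using G(3) T by (auto simp: less_Suc_eq)
        ultimately have "I (Suc c) (\<sigma>''(11 := Suc c))"
          unfolding I_def using G(1,2) TF by (intro exI[of _ "insert ?T G"]) auto
        then show "?Q \<sigma>''" using \<open>\<sigma>'' 11 = \<sigma>' 11\<close> c by simp
      qed
    next
      assume "eval \<sigma>' (test_exp t (Suc s)) = 0"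
      then have no: "\<not> (closed_set E ?T \<and> ?T \<inter> \<Union>G = {})" using test(2) by auto
      \<comment> \<open>A component is closed, so the test can reject it only because of a mark;
        then it meets a counted component and equals it.\<close>
      have "?T \<in> G" if "?T \<in> found E L (Suc s)"
      proof -
        have TC: "?T \<in> conn_comps n E" using that by (simp add: found_def)
        then have "?T \<inter> \<Union>G \<noteq> {}" using no closed_set_component[OF E] by blast
        then obtain C where C: "C \<in> G" "?T \<inter> C \<noteq> {}" by blast
        then have "?T = C" using components_disjoint[OF TC G_comp[OF C(1)]] by blast
        then show ?thesis using C by simp
      qed
      then have "I (Suc c) (\<sigma>'(11 := Suc c))"
        unfolding I_def using G cnt T by (intro exI[of _ G]) (auto simp: less_Suc_eq)
      then show "wp Nop ?Q \<sigma>'" using c by (intro wp_Nop) simp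
    qed
  qed simp
qed

lemma wp_estimate_com:
  assumes L: "valid L" and E: "graph_on n E" and st: "st E L \<sigma>"
  shows "wp (estimate_com t) (\<lambda>\<sigma>'. st E L \<sigma>' \<and> \<sigma>' 0 = estimate n E t P (set L)) \<sigma>"
proof -
  define I where "I k \<sigma>' \<longleftrightarrow> st E L \<sigma>' \<and> \<sigma>' 0 = 0 \<and> (\<forall>i<k. \<sigma>' (ad i 1) = 0)" for k \<sigma>'
  \<comment> \<open>Components are nonempty, so stage \<open>0\<close> starts with nothing counted
    and all marks cleared.\<close>
  have found0: "found E L 0 = {}"
    using component_nonempty component_finite by (fastforce simp: found_def)
  have clear: "wp (For 10 (Var 6) (Put (Adr t (Var 10) 1) (Num 0))) (counted E L (found E L 0)) (\<sigma>(0 := 0))"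
  proof (rule wp_For[where I = I and M = "length L"])
    show "length L < 2 ^ w" using valid_length[OF L] n_less by simp
    show "I 0 (\<sigma>(0 := 0, 10 := 0))" using st by (simp add: I_def)
    show "safe \<sigma>' (Var 6) \<and> eval \<sigma>' (Var 6) = length L" if "I k \<sigma>'" for k \<sigma>'
      using that by (auto simp: I_def st_def)
    show "counted E L (found E L 0) \<sigma>'" if "I (length L) \<sigma>'" for \<sigma>'
      using that by (auto simp: I_def counted_def found0 marks_def)
  next
    fix i \<sigma>' assume i: "i < length L" "\<sigma>' 10 = i" and I: "I i \<sigma>'"
    have "eval \<sigma>' (Adr t (Var 10) 1) = ad i 1"
      using eval_Adr[OF L, of \<sigma>' "Var 10" 1] i by simp
    moreover have "I (Suc i) (\<sigma>'(ad i 1 := 0, 10 := Suc i))"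
      using I by (auto simp: I_def less_Suc_eq)
    ultimately show "wp (Put (Adr t (Var 10) 1) (Num 0))
        (\<lambda>\<sigma>''. \<sigma>'' 10 = i \<and> I (Suc i) (\<sigma>''(10 := Suc i))) \<sigma>'"
      using in_mem_ad[OF L i(1), of 1] i by (intro wp_Put) auto
  qed simp
  have all: "wp (unroll t (\<lambda>s. stage_com t (Suc s))) (counted E L (found E L t)) \<sigma>'"
    if "counted E L (found E L 0) \<sigma>'" for \<sigma>'
    by (rule wp_unroll[where I = "\<lambda>s. counted E L (found E L s)"])
       (use that wp_stage_com[OF L E] in auto)
  have stages: "wp (unroll t (\<lambda>s. stage_com t (Suc s)))
      (\<lambda>\<sigma>'. st E L \<sigma>' \<and> \<sigma>' 0 = estimate n E t P (set L)) \<sigma>'"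
    if "counted E L (found E L 0) \<sigma>'" for \<sigma>'
    by (rule wp_mono[OF all[OF that]]) (auto simp: counted_def estimate_def found_def)
  have "wp (Then (For 10 (Var 6) (Put (Adr t (Var 10) 1) (Num 0))) (unroll t (\<lambda>s. stage_com t (Suc s))))
      (\<lambda>\<sigma>'. st E L \<sigma>' \<and> \<sigma>' 0 = estimate n E t P (set L)) (\<sigma>(0 := 0))"
    by (rule wp_Then, rule wp_mono[OF clear]) (rule stages)
  then show ?thesis
    unfolding estimate_com_def by - (rule wp_Then[OF wp_Put], simp_all)
qed

lemma wp_update_com:
  assumes L: "valid L" and st: "st E L \<sigma>" and E: "graph_on n E" and x: "legal_update n E x"
    and \<sigma>: "\<sigma> 0 = (case x of Insert _ _ \<Rightarrow> 1 | Delete _ _ \<Rightarrow> 0)"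
      "\<sigma> 1 = (case x of Insert u v \<Rightarrow> u | Delete u v \<Rightarrow> u)"
      "\<sigma> 2 = (case x of Insert u v \<Rightarrow> v | Delete u v \<Rightarrow> v)"
  shows "wp (update_com t) (\<lambda>\<sigma>'. st (apply_update E x) L \<sigma>' \<and>
    \<sigma>' 0 = estimate n (apply_update E x) t P (set L)) \<sigma>"
  unfolding update_com_def
  by (rule wp_Then, rule wp_mono[OF wp_edges[OF L st E x \<sigma>]])
     (rule wp_estimate_com[OF L graph_on_apply_update[OF E x]])

end

section \<open>Drawing the sample with fair coins\<close>

section \<open>Sampling\<close>

text \<open>With \<open>p = 1 / 2\<close> this splits off one fair coin from a bit of probability
  \<open>1 / 2 ^ Suc j\<close>.\<close>

lemma bernoulli_pmf_mult:
  assumes "0 \<le> p" "p \<le> 1" "0 \<le> q" "q \<le> 1"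
  shows "bernoulli_pmf (p * q) = bind_pmf (bernoulli_pmf p) (\<lambda>y. map_pmf (\<lambda>x. x \<and> y) (bernoulli_pmf q))"
proof (rule pmf_eqI)
  fix z
  have pq: "0 \<le> p * q" "p * q \<le> 1" using assms by (auto simp: mult_le_one)
  show "pmf (bernoulli_pmf (p * q)) z =
      pmf (bind_pmf (bernoulli_pmf p) (\<lambda>y. map_pmf (\<lambda>x. x \<and> y) (bernoulli_pmf q))) z"
    using assms pq by (cases z) (simp_all add: pmf_bind map_pmf_const algebra_simps)
qed

lemma sample_0: "sample 0 P = return_pmf (\<lambda>_. False)"
  by (simp add: sample_def)

lemma sample_Suc:
  "sample (Suc k) P = bind_pmf (sample k P)
     (\<lambda>f. map_pmf (\<lambda>x. f(Suc k := x)) (bernoulli_pmf (1 / real P)))"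
proof -
  have "sample (Suc k) P = Pi_pmf (insert (Suc k) {1..k}) False (\<lambda>_. bernoulli_pmf (1 / real P))"
    unfolding sample_def by (simp add: atLeastAtMostSuc_conv)
  also have "\<dots> = bind_pmf (sample k P)
     (\<lambda>f. map_pmf (\<lambda>x. f(Suc k := x)) (bernoulli_pmf (1 / real P)))"
    by (subst Pi_pmf_insert') (auto simp: sample_def map_pmf_def intro: bind_commute_pmf)
  finally show ?thesis .
qed

text \<open>The cut at \<open>cap\<close> keeps the memory bounded for every outcome of the coins;
  when the sample has at most \<open>cap\<close> vertices it changes nothing.\<close>

definition sampled :: "nat \<Rightarrow> nat \<Rightarrow> (nat \<Rightarrow> bool) \<Rightarrow> nat list" where
  "sampled cap k f = take cap (filter f [1..<Suc k])"

lemma sampled_Suc: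
  "sampled cap (Suc k) (f(Suc k := x)) =
     (if x \<and> length (sampled cap k f) < cap then sampled cap k f @ [Suc k] else sampled cap k f)"
proof -
  have "filter (f(Suc k := x)) [1..<Suc k] = filter f [1..<Suc k]"
    by (rule filter_cong) auto
  then show ?thesis by (auto simp: sampled_def)
qed

text \<open>One bit is multiplied into cell \<open>8\<close> for each halving that takes cell
  \<open>9\<close> from \<open>P\<close> down to \<open>1\<close>, hence \<open>log 2 P\<close> bits
  in all.\<close>

definition flips_com :: com where
  "flips_com = Loop (Bin Less (Num 1) (Var 9)) (Then (Toss 13)
     (Then (Asg 8 (Bin Mul (Var 8) (Var 13))) (Asg 9 (Bin Div (Var 9) (Num 2)))))"

definition vertex_com :: "nat \<Rightarrow> com" where
  "vertex_com t = Then (Asg 8 (Num 1)) (Then (Asg 9 (Var 4)) (Then flips_com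
     (If (Var 8) (If (Bin Less (Var 6) (Var 5))
        (Then (Put (Adr t (Var 6) 0) (Bin Add (Var 7) (Num 1))) (Asg 6 (Bin Add (Var 6) (Num 1))))
      Nop) Nop)))"

text \<open>\<open>P\<close> is doubled as long as \<open>c * (2 * P) ^ t \<le> n\<close>, written
  as the negation of \<open>Less\<close>.\<close>

definition rate_com :: "nat \<Rightarrow> nat \<Rightarrow> com" where
  "rate_com t c = Loop
     (Bin Eq (Bin Less (Var 3) (Bin Mul (Num c) (pow_exp (Bin Mul (Num 2) (Var 4)) t))) (Num 0))
     (Asg 4 (Bin Mul (Num 2) (Var 4)))"

text \<open>The estimate for the empty graph is computed at once, so that cell \<open>0\<close> is
  right even if no update follows.\<close>

definition init_com :: "nat \<Rightarrow> nat \<Rightarrow> com" where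
  "init_com t c = Then (Asg 3 (Var 0)) (Then (Asg 4 (Num 1)) (Then (rate_com t c)
     (Then (Asg 5 (Bin Div (Bin Mul (Num 6) (Var 3)) (Var 4)))
     (Then (For 7 (Var 3) (vertex_com t)) (estimate_com t)))))"

context ram
begin

lemma rwp_Then_wp: "wp c1 (rwp c2 D Q) \<sigma> \<Longrightarrow> rwp (Then c1 c2) D Q \<sigma>"
  using rwp_Then[of c1 "return_pmf ()" c2 "\<lambda>_. D" Q \<sigma>]
  unfolding wp_def by (simp add: bind_return_pmf)

lemma rwp_Then_map: "rwp c1 D (\<lambda>a. wp c2 (Q (g a))) \<sigma> \<Longrightarrow> rwp (Then c1 c2) (map_pmf g D) Q \<sigma>"
  unfolding map_pmf_def
  by (rule rwp_Then, erule rwp_mono) (rule wp_rwp)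

lemma rwp_For:
  fixes I :: "nat \<Rightarrow> 'a \<Rightarrow> (nat \<Rightarrow> nat) \<Rightarrow> bool"
  assumes i: "i < 16" and M: "M < 2 ^ w"
    and D0: "D 0 = return_pmf a0" and DS: "\<And>k. D (Suc k) = bind_pmf (D k) (K k)"
    and init: "I 0 a0 (\<sigma>(i := 0))"
    and bound: "\<And>k a \<sigma>. I k a \<sigma> \<Longrightarrow> safe \<sigma> e \<and> eval \<sigma> e = M"
    and step: "\<And>k a \<sigma>. k < M \<Longrightarrow> \<sigma> i = k \<Longrightarrow> I k a \<sigma> \<Longrightarrow>
      rwp c (K k a) (\<lambda>a' \<sigma>'. \<sigma>' i = k \<and> I (Suc k) a' (\<sigma>'(i := Suc k))) \<sigma>"
  shows "rwp (For i e c) (D M) (I M) \<sigma>"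
proof -
  let ?L = "Loop (Bin Less (Var i) e) (Then c (Asg i (Bin Add (Var i) (Num 1))))"
  \<comment> \<open>The loop rule composes laws from the first round onwards, while \<open>D\<close>
    is extended at its end; \<open>rest d k\<close> is the law of the \<open>d\<close> rounds from
    round \<open>k\<close> on, and bridges the two.\<close>
  define rest :: "nat \<Rightarrow> nat \<Rightarrow> 'a \<Rightarrow> 'a pmf" where
    "rest = rec_nat (\<lambda>k. return_pmf) (\<lambda>d R k a. bind_pmf (K k a) (R (Suc k)))"
  have rest: "rest 0 k = return_pmf" "rest (Suc d) k a = bind_pmf (K k a) (rest d (Suc k))" for d k a
    by (simp_all add: rest_def)
  have D: "bind_pmf (D k) (rest d k) = D (k + d)" for k d
  proof (induction d arbitrary: k)
    case (Suc d)
    then show ?case using Suc[of "Suc k"] by (simp add: rest(2) DS bind_assoc_pmf)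
  qed (simp add: rest bind_return_pmf')
  have loop: "rwp ?L (rest d k a) (I M) \<sigma>" if "k + d = M" "\<sigma> i = k" "I k a \<sigma>" for k d a \<sigma>
    using that
  proof (induction d arbitrary: k a \<sigma>)
    case 0
    with bound[of k a \<sigma>] i show ?case
      unfolding rest by (intro rwp_Loop_done) auto
  next
    case (Suc d)
    then have k: "k < M" by simp
    have b: "safe \<sigma> e" "eval \<sigma> e = M" using bound Suc.prems by auto
    show ?case
      unfolding rest
    proof (rule rwp_Loop_step)
      have "rwp c (K k a) (\<lambda>a'. wp (Asg i (Bin Add (Var i) (Num 1)))
          (\<lambda>\<sigma>'. \<sigma>' i = Suc k \<and> I (Suc k) a' \<sigma>')) \<sigma>"
        by (rule rwp_mono[OF step[OF k Suc.prems(2,3)]])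
           (use i k M in \<open>auto intro!: wp_Put\<close>)
      then have "rwp (Then c (Asg i (Bin Add (Var i) (Num 1)))) (map_pmf (\<lambda>a. a) (K k a))
          (\<lambda>a' \<sigma>'. \<sigma>' i = Suc k \<and> I (Suc k) a' \<sigma>') \<sigma>"
        by (rule rwp_Then_map)
      then show "rwp (Then c (Asg i (Bin Add (Var i) (Num 1)))) (K k a)
          (\<lambda>a'. rwp ?L (rest d (Suc k) a') (I M)) \<sigma>"
        unfolding pmf.map_ident by (rule rwp_mono) (use Suc in auto)
    qed (use b k i Suc.prems in auto)
  qed
  have "D M = rest M 0 a0" using D[of 0 M] by (simp add: D0 bind_return_pmf)
  then show ?thesis
    unfolding For_def using i init loop[of 0 M "\<sigma>(i := 0)" a0]
    by - (rule rwp_Then_wp[OF wp_Put], auto)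
qed

lemma rwp_flips_com:
  assumes "\<sigma> 9 = 2 ^ j" "(2::nat) ^ j < 2 ^ w" "\<sigma> 8 = of_bool f"
  shows "rwp flips_com (map_pmf (\<lambda>x. x \<and> f) (bernoulli_pmf (1 / 2 ^ j)))
    (\<lambda>x \<sigma>'. \<sigma>' 8 = of_bool x \<and> (\<forall>a. a \<notin> {8, 9, 13} \<longrightarrow> \<sigma>' a = \<sigma> a)) \<sigma>"
  using assms
proof (induction j arbitrary: \<sigma> f)
  case 0
  have "bernoulli_pmf 1 = return_pmf True"
    by (rule pmf_eqI) (auto simp: pmf_return indicator_def elim!: bool.exhaust split: if_splits)
  then have "map_pmf (\<lambda>x. x \<and> f) (bernoulli_pmf (1 / 2 ^ 0)) = return_pmf f" by simp
  with 0 show ?case unfolding flips_com_def by (auto intro!: rwp_Loop_done)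
next
  case (Suc j)
  let ?Q = "\<lambda>x \<sigma>'. \<sigma>' 8 = of_bool x \<and> (\<forall>a. a \<notin> {8, 9, 13} \<longrightarrow> \<sigma>' a = \<sigma> a)"
  let ?B = "Then (Toss 13) (Then (Asg 8 (Bin Mul (Var 8) (Var 13))) (Asg 9 (Bin Div (Var 9) (Num 2))))"
  have half: "(2::nat) ^ j < 2 ^ w" using Suc.prems(2) unfolding power_Suc by linarith
  have D: "map_pmf (\<lambda>x. x \<and> f) (bernoulli_pmf (1 / 2 ^ Suc j)) =
      bind_pmf (bernoulli_pmf (1 / 2)) (\<lambda>y. map_pmf (\<lambda>x. x \<and> (y \<and> f)) (bernoulli_pmf (1 / 2 ^ j)))"
    using bernoulli_pmf_mult[of "1 / 2" "1 / 2 ^ j"]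
    by (simp add: map_bind_pmf pmf.map_comp o_def conj_assoc)
  have "rwp ?B (map_pmf (\<lambda>y. y) (bernoulli_pmf (1 / 2)))
      (\<lambda>y \<sigma>'. \<sigma>' 9 = 2 ^ j \<and> \<sigma>' 8 = of_bool (y \<and> f) \<and> (\<forall>a. a \<notin> {8, 9, 13} \<longrightarrow> \<sigma>' a = \<sigma> a)) \<sigma>"
    using Suc.prems by (intro rwp_Then_map rwp_Toss wp_Then wp_Put) auto
  then have "rwp ?B (bernoulli_pmf (1 / 2))
      (\<lambda>y. rwp flips_com (map_pmf (\<lambda>x. x \<and> (y \<and> f)) (bernoulli_pmf (1 / 2 ^ j))) ?Q) \<sigma>"
    unfolding pmf.map_ident
  proof (rule rwp_mono)
    fix y \<sigma>' assume \<sigma>': "\<sigma>' 9 = 2 ^ j \<and> \<sigma>' 8 = of_bool (y \<and> f) \<and> (\<forall>a. a \<notin> {8, 9, 13} \<longrightarrow> \<sigma>' a = \<sigma> a)"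
    show "rwp flips_com (map_pmf (\<lambda>x. x \<and> (y \<and> f)) (bernoulli_pmf (1 / 2 ^ j))) ?Q \<sigma>'"
      by (rule rwp_mono[OF Suc.IH[OF _ half]]) (use \<sigma>' in auto)
  qed
  then show ?case
    unfolding D unfolding flips_com_def
    by (rule rwp_Loop_step[rotated 2])
       (use Suc.prems one_less_power[of "2::nat" "Suc j"] in auto)
qed

end

text \<open>\<open>rate_le\<close> and \<open>rate_gt\<close> make \<open>J\<close> the number of
  doublings after which the rate loop stops; \<open>word_rate\<close> ensures that even its last,
  failing test is computed without overflow.\<close>

locale sampler = alg w b N t n P for w b N t n P +
  fixes c J :: nat
  assumes P_eq: "P = 2 ^ J"
    and rate_le: "\<And>i. i < J \<Longrightarrow> c * (2 * 2 ^ i) ^ t \<le> n"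
    and rate_gt: "n < c * (2 * 2 ^ J) ^ t"
    and word_rate: "c * (2 * 2 ^ J) ^ t < 2 ^ w"
    and word_cap: "6 * n < 2 ^ w"
    and mem_cap: "ad (6 * n div P) 0 \<le> N"
begin

definition cap :: nat where "cap = 6 * n div P"

lemma valid_sampled: "k \<le> n \<Longrightarrow> valid (sampled cap k f)"
proof -
  assume k: "k \<le> n"
  let ?L = "sampled cap k f"
  have "set ?L \<subseteq> {1..k}" unfolding sampled_def by (rule subset_trans[OF set_take_subset]) auto
  moreover have "length ?L \<le> cap" by (simp add: sampled_def)
  then have "ad (length ?L) 0 \<le> ad cap 0" unfolding ad_def by (intro add_mono mult_right_mono) auto
  ultimately show ?thesis using mem_cap k by (auto simp: valid_def sampled_def cap_def)
qed

lemma P_less: "P < 2 ^ w"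
  using P_pow_less[of 1] t_pos by simp

text \<open>The zeros of fresh memory are the correct power sums of the empty graph; demanding them
  for all \<open>i\<close> covers the records that are still to be appended.\<close>

definition sampling :: "nat \<Rightarrow> (nat \<Rightarrow> bool) \<Rightarrow> (nat \<Rightarrow> nat) \<Rightarrow> bool" where
  "sampling k f \<sigma> \<longleftrightarrow> \<sigma> 3 = n \<and> \<sigma> 4 = P \<and> \<sigma> 5 = cap \<and> \<sigma> 6 = length (sampled cap k f) \<and>
     (\<forall>i<length (sampled cap k f). \<sigma> (ad i 0) = sampled cap k f ! i) \<and>
     (\<forall>i. \<forall>l\<le>2 * t. \<sigma> (ad i (2 + l)) = 0)"

lemma sampling_cong:
  assumes "sampling k f \<sigma>" "\<And>a. a \<notin> {7, 8, 9, 13} \<Longrightarrow> \<sigma>' a = \<sigma> a"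
  shows "sampling k f \<sigma>'"
  using assms by (simp add: sampling_def)

lemma rwp_vertex_com:
  assumes k: "k < n" and \<sigma>: "\<sigma> 7 = k" and inv: "sampling k f \<sigma>"
  shows "rwp (vertex_com t) (map_pmf (\<lambda>x. f(Suc k := x)) (bernoulli_pmf (1 / real P)))
    (\<lambda>f' \<sigma>'. \<sigma>' 7 = k \<and> sampling (Suc k) f' (\<sigma>'(7 := Suc k))) \<sigma>"
proof -
  let ?L = "sampled cap k f"
  let ?Q = "\<lambda>f' \<sigma>'. \<sigma>' 7 = k \<and> sampling (Suc k) f' (\<sigma>'(7 := Suc k))"
  let ?I = "If (Var 8) (If (Bin Less (Var 6) (Var 5))
        (Then (Put (Adr t (Var 6) 0) (Bin Add (Var 7) (Num 1))) (Asg 6 (Bin Add (Var 6) (Num 1))))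
      Nop) Nop"
  have tail: "wp ?I (?Q (f(Suc k := x))) \<tau>"
    if \<tau>8: "\<tau> 8 = of_bool x" and \<tau>: "\<And>a. a \<notin> {8, 9, 13} \<Longrightarrow> \<tau> a = \<sigma> a" for x \<tau>
  proof -
    have \<tau>7: "\<tau> 7 = k" using \<tau> \<sigma> by simp
    have inv': "sampling k f \<tau>" by (rule sampling_cong[OF inv]) (use \<tau> in auto)
    have nop: "wp Nop (?Q (f(Suc k := x))) \<tau>" if "\<not> (x \<and> length ?L < cap)"
      using inv' \<tau>7 that by (intro wp_Nop) (auto simp: sampling_def sampled_Suc)
    show ?thesis
    proof (rule wp_If)
      assume "eval \<tau> (Var 8) \<noteq> 0"
      then have x: x using \<tau>8 by simp
      show "wp (If (Bin Less (Var 6) (Var 5))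
        (Then (Put (Adr t (Var 6) 0) (Bin Add (Var 7) (Num 1))) (Asg 6 (Bin Add (Var 6) (Num 1))))
          Nop) (?Q (f(Suc k := x))) \<tau>"
      proof (rule wp_If)
        assume "eval \<tau> (Bin Less (Var 6) (Var 5)) \<noteq> 0"
        then have less: "length ?L < cap" using inv' by (auto simp: sampling_def split: if_splits)
        have new: "sampled cap (Suc k) (f(Suc k := x)) = ?L @ [Suc k]"
          using x less by (simp add: sampled_Suc)
        then have val: "valid (?L @ [Suc k])" using valid_sampled[of "Suc k" "f(Suc k := x)"] k by simp
        have \<tau>6: "\<tau> 6 = length ?L" using inv' by (simp add: sampling_def)
        have e: "eval \<tau> (Adr t (Var 6) 0) = ad (length ?L) 0"
          using eval_Adr[OF val, of \<tau> "Var 6" 0] \<tau>6 by simp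
        have m: "in_mem (ad (length ?L) 0)" using in_mem_ad[OF val, of "length ?L" 0] by simp
        have len: "Suc (length ?L) < 2 ^ w" using valid_length[OF val] n_less by simp
        have "ad i (Suc (Suc l)) \<noteq> ad (length ?L) 0" if "l \<le> 2 * t" for i l
          using that ad_eq[of "Suc (Suc l)" 0 i "length ?L"] by simp
        then have "sampling (Suc k) (f(Suc k := x)) (\<tau>(ad (length ?L) 0 := Suc k, 6 := Suc (length ?L), 7 := Suc k))"
          using inv' unfolding sampling_def new by (auto simp: nth_append less_Suc_eq)
        then have "?Q (f(Suc k := x)) (\<tau>(ad (length ?L) 0 := Suc k, 6 := Suc (length ?L)))"
          using \<tau>7 by simp
        then show "wp (Then (Put (Adr t (Var 6) 0) (Bin Add (Var 7) (Num 1)))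
            (Asg 6 (Bin Add (Var 6) (Num 1)))) (?Q (f(Suc k := x))) \<tau>"
          using e m len \<tau>6 \<tau>7 k n_less by (intro wp_Then wp_Put) auto
      next
        assume "eval \<tau> (Bin Less (Var 6) (Var 5)) = 0"
        then show "wp Nop (?Q (f(Suc k := x))) \<tau>"
          using inv' by (intro nop) (auto simp: sampling_def split: if_splits)
      qed simp
    next
      assume "eval \<tau> (Var 8) = 0"
      then show "wp Nop (?Q (f(Suc k := x))) \<tau>" using \<tau>8 by (intro nop) simp
    qed simp
  qed
  have \<sigma>4: "\<sigma> 4 = P" using inv by (simp add: sampling_def)
  have flips: "rwp flips_com (map_pmf (\<lambda>x. x \<and> True) (bernoulli_pmf (1 / 2 ^ J)))
    (\<lambda>x \<sigma>'. \<sigma>' 8 = of_bool x \<and> (\<forall>a. a \<notin> {8, 9, 13} \<longrightarrow> \<sigma>' a = (\<sigma>(8 := 1, 9 := P)) a)) (\<sigma>(8 := 1, 9 := P))"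
    by (rule rwp_flips_com) (use P_eq P_less in auto)
  have "map_pmf (\<lambda>x. x \<and> True) (bernoulli_pmf (1 / 2 ^ J)) = bernoulli_pmf (1 / real P)"
    by (simp add: P_eq)
  then have "rwp flips_com (bernoulli_pmf (1 / real P))
    (\<lambda>x. wp ?I (?Q (f(Suc k := x)))) (\<sigma>(8 := 1, 9 := P))"
    using rwp_mono[OF flips, of "\<lambda>x. wp ?I (?Q (f(Suc k := x)))"] tail by simp
  then show ?thesis
    unfolding vertex_com_def using \<sigma>4 rwp_Then_map
    by - (rule rwp_Then_wp[OF wp_Put], (simp; fail)+, rule rwp_Then_wp[OF wp_Put], simp_all)
qed

lemma wp_rate_com:
  assumes "\<sigma> 3 = n" "\<sigma> 4 = 1" "Q (\<sigma>(4 := P))"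
  shows "wp (rate_com t c) Q \<sigma>"
proof -
  let ?e = "Bin Mul (Num c) (pow_exp (Bin Mul (Num 2) (Var 4)) t)"
  have e: "eval \<tau> ?e = c * (2 * 2 ^ i) ^ t" if "\<tau> 4 = 2 ^ i" "i \<le> J" for \<tau> i
  proof -
    have "c * (2 * 2 ^ i) ^ t \<le> c * (2 * 2 ^ J) ^ t"
      using that by (intro mult_left_mono power_mono power_increasing) auto
    then have "c * (2 * 2 ^ i) ^ t < 2 ^ w" using word_rate by (rule le_less_trans)
    moreover have "eval \<tau> ?e = (c * (2 * 2 ^ i) ^ t) mod 2 ^ w"
      using that by (simp add: eval_pow_exp mod_simps power_mod)
    ultimately show ?thesis by simp
  qed
  have "wp (rate_com t c) Q \<tau>" if "\<tau> = \<sigma>(4 := 2 ^ i)" "i \<le> J" for \<tau> i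
    using that
  proof (induction "J - i" arbitrary: i \<tau>)
    case 0
    then have "i = J" by simp
    have "eval \<tau> (Bin Eq (Bin Less (Var 3) ?e) (Num 0)) = 0"
      using 0 \<open>i = J\<close> assms rate_gt e[of \<tau> J] by simp
    moreover have "Q \<tau>" using assms(3) unfolding 0(2) \<open>i = J\<close> P_eq .
    ultimately show ?case
      unfolding rate_com_def by (intro wp_Loop_done) auto
  next
    case (Suc d)
    have "wp (rate_com t c) Q (\<sigma>(4 := 2 ^ Suc i))" using Suc by (intro Suc.hyps(1)[of "Suc i"]) auto
    moreover have "(2::nat) ^ Suc i \<le> 2 ^ J" using Suc.hyps(2) by (intro power_increasing) auto
    then have "2 * 2 ^ i < (2::nat) ^ w" using P_less by (metis P_eq le_less_trans power_Suc)
    ultimately have "wp (Asg 4 (Bin Mul (Num 2) (Var 4))) (wp (rate_com t c) Q) \<tau>"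
      using Suc.prems by (intro wp_Put) auto
    moreover have "i < J" using Suc.hyps(2) by simp
    then have "eval \<tau> (Bin Eq (Bin Less (Var 3) ?e) (Num 0)) \<noteq> 0"
      using Suc.prems assms rate_le[of i] e[of \<tau> i] by simp
    ultimately show ?case
      unfolding rate_com_def by (intro wp_Loop_step) auto
  qed
  from this[of "\<sigma>(4 := 2 ^ 0)" 0] assms show ?thesis by (metis fun_upd_triv le0 power_0)
qed

lemma rwp_init_com:
  "rwp (init_com t c) (sample n P) (\<lambda>f \<sigma>. st {} (sampled cap n f) \<sigma> \<and>
     \<sigma> 0 = estimate n {} t P (set (sampled cap n f))) ((\<lambda>_. 0)(0 := n))"
proof -
  let ?Q = "\<lambda>f \<sigma>. st {} (sampled cap n f) \<sigma> \<and> \<sigma> 0 = estimate n {} t P (set (sampled cap n f))"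
  define \<sigma> where "\<sigma> = (\<lambda>_::nat. 0::nat)(0 := n, 3 := n, 4 := P, 5 := cap)"
  have "rwp (For 7 (Var 3) (vertex_com t)) (sample n P) (sampling n) \<sigma>"
  proof (rule rwp_For[where D = "\<lambda>k. sample k P" and I = sampling and M = n, OF _ _ sample_0 sample_Suc])
    show "sampling 0 (\<lambda>_. False) (\<sigma>(7 := 0))" by (simp add: sampling_def \<sigma>_def sampled_def)
    show "safe \<tau> (Var 3) \<and> eval \<tau> (Var 3) = n" if "sampling k f \<tau>" for k f \<tau>
      using that by (simp add: sampling_def)
  qed (use n_less rwp_vertex_com in auto)
  then have "rwp (For 7 (Var 3) (vertex_com t)) (sample n P) (\<lambda>f. wp (estimate_com t) (?Q f)) \<sigma>"
  proof (rule rwp_mono)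
    fix f \<tau> assume "sampling n f \<tau>"
    then have "st {} (sampled cap n f) \<tau>" by (simp add: st_def sampling_def psum_def nbrs_def)
    then show "wp (estimate_com t) (?Q f) \<tau>"
      by (intro wp_estimate_com valid_sampled graph_on_empty) simp
  qed
  then have "rwp (Then (For 7 (Var 3) (vertex_com t)) (estimate_com t)) (map_pmf (\<lambda>f. f) (sample n P)) ?Q \<sigma>"
    by (rule rwp_Then_map[where g = "\<lambda>f. f"])
  then have "wp (Asg 5 (Bin Div (Bin Mul (Num 6) (Var 3)) (Var 4)))
      (rwp (Then (For 7 (Var 3) (vertex_com t)) (estimate_com t)) (sample n P) ?Q)
      ((\<lambda>_. 0)(0 := n, 3 := n, 4 := P))"
    using word_cap by (intro wp_Put) (auto simp: \<sigma>_def cap_def pmf.map_ident)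
  then have "rwp (Then (Asg 5 (Bin Div (Bin Mul (Num 6) (Var 3)) (Var 4)))
      (Then (For 7 (Var 3) (vertex_com t)) (estimate_com t))) (sample n P) ?Q
      ((\<lambda>_. 0)(0 := n, 3 := n, 4 := P))"
    by (rule rwp_Then_wp)
  then have "wp (rate_com t c) (rwp (Then (Asg 5 (Bin Div (Bin Mul (Num 6) (Var 3)) (Var 4)))
      (Then (For 7 (Var 3) (vertex_com t)) (estimate_com t))) (sample n P) ?Q)
      ((\<lambda>_. 0)(0 := n, 3 := n, 4 := 1))"
    by (intro wp_rate_com) simp_all
  then have "rwp (Then (rate_com t c) (Then (Asg 5 (Bin Div (Bin Mul (Num 6) (Var 3)) (Var 4)))
      (Then (For 7 (Var 3) (vertex_com t)) (estimate_com t)))) (sample n P) ?Q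
      ((\<lambda>_. 0)(0 := n, 3 := n, 4 := 1))"
    by (rule rwp_Then_wp)
  then show ?thesis
    unfolding init_com_def
    by - (rule rwp_Then_wp[OF wp_Put], (simp; fail)+, rule rwp_Then_wp[OF wp_Put], simp_all)
qed

end

section \<open>Choice of parameters and analysis of complete runs\<close>

section \<open>The streaming algorithm\<close>

definition base :: "nat \<Rightarrow> nat \<Rightarrow> nat" where
  "base t c = 16 + max (stack_com (init_com t c)) (stack_com (update_com t))"

definition rate_exponent :: "nat \<Rightarrow> nat \<Rightarrow> nat \<Rightarrow> nat" where
  "rate_exponent t c n = (LEAST j. n < c * (2 * 2 ^ j) ^ t)"

definition rate :: "nat \<Rightarrow> nat \<Rightarrow> nat \<Rightarrow> nat" where
  "rate t c n = 2 ^ rate_exponent t c n"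

text \<open>Dominates \<open>a + e\<close> for each quantity of the form
  \<open>a * (n + 1) ^ e\<close> that has to fit into a word: memory size, certificate, estimate,
  last rate test and \<open>6 * n\<close>.\<close>

definition factor :: "nat \<Rightarrow> nat \<Rightarrow> nat" where
  "factor t c = base t c + 6 * (2 * t + 3) + 2 ^ t * c + 3 * t + 10"

definition cc_alg :: "nat \<Rightarrow> nat \<Rightarrow> streaming_alg" where
  "cc_alg t c = \<lparr>
     word_factor = factor t c,
     cells = (\<lambda>n. base t c + (6 * n div rate t c n) * (2 * t + 3)),
     init_prog = compile (base t c) (init_com t c),
     update_prog = compile (base t c) (update_com t),
     post_prog = Skip\<rparr>"

lemma rate_exponent:
  assumes "1 \<le> t" "1 \<le> c"
  shows "n < c * (2 * 2 ^ rate_exponent t c n) ^ t"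
    and "i < rate_exponent t c n \<Longrightarrow> c * (2 * 2 ^ i) ^ t \<le> n"
proof -
  \<comment> \<open>The exponent \<open>n\<close> itself witnesses that the least one
    exists.\<close>
  have "n < 2 * 2 ^ n" by (metis less_exp less_trans power_Suc lessI)
  also have "\<dots> = 1 * (2 * 2 ^ n) ^ 1" by simp
  also have "\<dots> \<le> c * (2 * 2 ^ n) ^ t"
    using assms by (intro mult_mono power_increasing) auto
  finally show "n < c * (2 * 2 ^ rate_exponent t c n) ^ t"
    unfolding rate_exponent_def by (rule LeastI)
  show "c * (2 * 2 ^ i) ^ t \<le> n" if "i < rate_exponent t c n"
    using not_less_Least[OF that[unfolded rate_exponent_def]] by simp
qed

lemma rate_cases:
  assumes "1 \<le> t" "1 \<le> c"
  shows "rate t c n = 1 \<or> c * rate t c n ^ t \<le> n"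
proof (cases "rate_exponent t c n")
  case (Suc j)
  then show ?thesis using rate_exponent(2)[OF assms, of j n] by (simp add: rate_def)
qed (simp add: rate_def)

text \<open>\<open>floorlog 2 n\<close> bits hold all numbers up to \<open>n\<close>, so
  \<open>n + 1 \<le> 2 ^ floorlog 2 n\<close>; the coefficient is absorbed by
  \<open>a < 2 ^ a \<le> (n + 1) ^ a\<close>.\<close>

lemma word_bound:
  assumes "a + e \<le> factor t c" "1 \<le> n"
  shows "a * (n + 1) ^ e < 2 ^ word_size (cc_alg t c) n"
proof -
  have "a * (n + 1) ^ e < 2 ^ a * (n + 1) ^ e" by (intro mult_strict_right_mono less_exp) auto
  also have "\<dots> \<le> (n + 1) ^ a * (n + 1) ^ e" using assms by (intro mult_right_mono power_mono) auto
  also have "\<dots> \<le> (n + 1) ^ factor t c"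
    unfolding power_add[symmetric] using assms by (intro power_increasing) auto
  also have "\<dots> \<le> (2 ^ floorlog 2 n) ^ factor t c"
    using floorlog_bounds[of n 2] assms by (intro power_mono) auto
  also have "\<dots> = 2 ^ word_size (cc_alg t c) n"
    by (simp add: word_size_def cc_alg_def mult.commute flip: power_mult)
  finally show ?thesis .
qed

lemma sampler_cc_alg:
  assumes t: "1 \<le> t" and c: "1 \<le> c" and n: "1 \<le> n"
  shows "sampler (word_size (cc_alg t c) n) (base t c) (cells (cc_alg t c) n) t n (rate t c n) c
     (rate_exponent t c n)"
proof -
  let ?w = "word_size (cc_alg t c) n" and ?b = "base t c" and ?N = "cells (cc_alg t c) n"
  let ?P = "rate t c n"
  have P: "1 \<le> ?P" by (simp add: rate_def)
  have "?P ^ t \<le> n + 1"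
    using rate_cases[OF t c, of n]
  proof
    assume "c * ?P ^ t \<le> n"
    moreover have "1 * ?P ^ t \<le> c * ?P ^ t" using c by (intro mult_right_mono) auto
    ultimately show ?thesis by linarith
  qed simp
  then have "n * ?P ^ t \<le> (n + 1) * (n + 1)" by (intro mult_mono) auto
  then have est: "n * ?P ^ t < 2 ^ ?w"
    using word_bound[of 1 2 t c n] n by (simp add: factor_def power2_eq_square)
  have ram: "ram ?w ?b ?N"
  proof
    show "16 \<le> ?b" by (simp add: base_def)
    show "?b \<le> ?N" by (simp add: cc_alg_def)
    have "?N \<le> ?b + (6 * n) * (2 * t + 3)"
      unfolding cc_alg_def by (simp del: mult_Suc_right distrib_left_numeral)
    also have "\<dots> \<le> ?b * (n + 1) + (6 * (2 * t + 3)) * (n + 1)"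
      by (intro add_mono) (auto simp: algebra_simps)
    also have "\<dots> = (?b + 6 * (2 * t + 3)) * (n + 1) ^ 1" by (simp add: algebra_simps)
    also have "\<dots> < 2 ^ ?w" using n by (intro word_bound) (auto simp: factor_def)
    finally show "?N \<le> 2 ^ ?w" by simp
  qed
  have "t * (n * n ^ (2 * t)) = t * n ^ (2 * t + 1)" by simp
  also have "\<dots> \<le> t * (n + 1) ^ (2 * t + 1)"
    by (intro mult_left_mono power_mono) auto
  also have "\<dots> < 2 ^ ?w" using n by (intro word_bound) (auto simp: factor_def)
  finally have big: "t * (n * n ^ (2 * t)) < 2 ^ ?w" .
  interpret alg ?w ?b ?N t n ?P
    using ram t n P est big by (simp add: alg_def alg_axioms_def)
  show ?thesis
  proof
    show "?P = 2 ^ rate_exponent t c n" by (simp add: rate_def)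
    show "c * (2 * 2 ^ i) ^ t \<le> n" if "i < rate_exponent t c n" for i
      using rate_exponent(2)[OF t c that] .
    show "n < c * (2 * 2 ^ rate_exponent t c n) ^ t" using rate_exponent(1)[OF t c] .
    have "c * ?P ^ t \<le> c * (n + 1)"
      using rate_cases[OF t c, of n]
    proof
      assume "c * ?P ^ t \<le> n"
      also have "n \<le> 1 * (n + 1)" by simp
      also have "\<dots> \<le> c * (n + 1)" using c by (intro mult_right_mono) auto
      finally show ?thesis .
    qed simp
    then have "2 ^ t * (c * ?P ^ t) \<le> 2 ^ t * (c * (n + 1))" by (rule mult_left_mono) simp
    moreover have "(2 ^ t * c) * (n + 1) ^ 1 < 2 ^ ?w"
      using n by (intro word_bound) (auto simp: factor_def)
    ultimately show "c * (2 * 2 ^ rate_exponent t c n) ^ t < 2 ^ ?w"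
      by (simp add: rate_def power_mult_distrib algebra_simps)
    show "6 * n < 2 ^ ?w" using word_bound[of 6 1 t c n] n by (simp add: factor_def)
    show "ad (6 * n div ?P) 0 \<le> ?N" by (simp add: ad_def cc_alg_def)
  qed
qed

lemma run_updates_snoc:
  "run_updates A n (xs @ [x]) m =
     bind_spmf (run_updates A n xs m) (\<lambda>m'. run (word_size A n) (update_prog A) (feed x m'))"
proof (induction xs arbitrary: m)
  case Nil
  then show ?case
    by (simp add: run_def map_spmf_conv_bind_spmf split_def)
next
  case (Cons y ys)
  then show ?case by (simp add: split_def)
qed

lemma run_alg_Skip:
  assumes "post_prog A = Skip"
  shows "run_alg A n xs =
    bind_spmf (run (word_size A n) (init_prog A) ((replicate (cells A n) 0)[0 := n])) (\<lambda>m0.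
    bind_spmf (run_updates A n xs m0) (\<lambda>m1. return_spmf (m1 ! 0, 0)))"
proof -
  have "exec w Skip m = return_spmf (m, 0)" for w m by (subst exec.simps) simp
  then show ?thesis
    unfolding run_alg_def run_def assms by (simp add: bind_map_spmf o_def split_def)
qed

lemma rel_pmf_in_set:
  assumes "rel_pmf R p q" "x \<in> set_pmf p"
  shows "\<exists>y. R x y"
  using assms by (force elim: rel_pmf.cases)

context sampler
begin

text \<open>All coins are tossed during initialisation. For a fixed sample the updates are
  deterministic, hence the coupling with a point mass.\<close>

lemma run_updates_cc_alg:
  assumes A: "A = cc_alg t c" and wbN: "w = word_size A n" "b = base t c" "N = cells A n"
    and xs: "dynamic_stream n xs" and L: "valid L" and st: "st {} L \<sigma>" and sim: "sim \<sigma> m"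
    and est: "\<sigma> 0 = estimate n {} t P (set L)"
  shows "rel_pmf (\<lambda>x _. \<exists>m' \<sigma>'. x = Some m' \<and> sim \<sigma>' m' \<and> st (stream_graph xs) L \<sigma>' \<and>
      \<sigma>' 0 = estimate n (stream_graph xs) t P (set L)) (run_updates A n xs m) (return_pmf ())"
  using xs
proof (induction xs rule: rev_induct)
  case Nil
  then show ?case using st sim est by (auto simp: stream_graph_def)
next
  case (snoc x xs)
  let ?E = "stream_graph xs"
  let ?E' = "apply_update ?E x"
  have dyn: "dynamic_stream n xs" and leg: "legal_update n ?E x"
    using snoc.prems by (auto simp: dynamic_stream_snoc)
  have stack: "16 + stack_com (update_com t) \<le> b" using wbN(2) by (simp add: base_def)
  have upd: "update_prog A = compile b (update_com t)" using A wbN(2) by (simp add: cc_alg_def)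
  have "rel_pmf (\<lambda>x _. \<exists>m' \<sigma>'. x = Some m' \<and> sim \<sigma>' m' \<and> st ?E' L \<sigma>' \<and>
      \<sigma>' 0 = estimate n ?E' t P (set L)) (run_updates A n (xs @ [x]) m)
      (bind_pmf (return_pmf ()) (\<lambda>_. return_pmf ()))"
    unfolding run_updates_snoc
  proof (rule rel_bind_spmf[OF snoc.IH[OF dyn]])
    fix y and a :: unit
    assume "\<exists>m' \<sigma>'. y = Some m' \<and> sim \<sigma>' m' \<and> st ?E L \<sigma>' \<and> \<sigma>' 0 = estimate n ?E t P (set L)"
    then obtain m' \<sigma>' where y: "y = Some m'" and sim': "sim \<sigma>' m'" and st': "st ?E L \<sigma>'" by blast
    define \<tau> where "\<tau> = \<sigma>'(0 := (case x of Insert _ _ \<Rightarrow> 1 | Delete _ _ \<Rightarrow> 0),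
      1 := (case x of Insert u v \<Rightarrow> u | Delete u v \<Rightarrow> u),
      2 := (case x of Insert u v \<Rightarrow> v | Delete u v \<Rightarrow> v))"
    have "sim \<tau> (feed x m')"
      using sim' b_ge b_le by (cases x) (auto simp: sim_def \<tau>_def in_mem_def nth_list_update)
    \<comment> \<open>Feeding an update touches only the cells \<open>0\<close>, \<open>1\<close>,
      \<open>2\<close>, which \<open>st\<close> leaves free.\<close>
    moreover have "st ?E L \<tau>" using st' by (simp add: st_def \<tau>_def)
    then have "wp (update_com t) (\<lambda>\<sigma>'. st ?E' L \<sigma>' \<and> \<sigma>' 0 = estimate n ?E' t P (set L)) \<tau>"
      by (rule wp_update_com[OF L _ graph_on_stream[OF dyn] leg]) (simp_all add: \<tau>_def)
    ultimately have "rel_pmf (\<lambda>x _. \<exists>m' \<sigma>'. x = Some m' \<and> sim \<sigma>' m' \<and> st ?E' L \<sigma>' \<and>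
        \<sigma>' 0 = estimate n ?E' t P (set L)) (run w (update_prog A) (feed x m')) (return_pmf ())"
      unfolding upd wp_def rwp_def using stack by blast
    then show "\<exists>m'. y = Some m' \<and> rel_pmf (\<lambda>x _. \<exists>m' \<sigma>'. x = Some m' \<and> sim \<sigma>' m' \<and> st ?E' L \<sigma>' \<and>
        \<sigma>' 0 = estimate n ?E' t P (set L)) (run (word_size A n) (update_prog A) (feed x m')) (return_pmf ())"
      using y wbN(1) by blast
  qed
  then show ?case by (simp add: bind_return_pmf stream_graph_snoc)
qed

text \<open>The ghost variable is the untruncated sample, so the probability of a good output can be
  read off from \<open>sample n P\<close>; each outcome is a result with \<open>0\<close>
  steps.\<close>

lemma run_cc_alg:
  assumes A: "A = cc_alg t c" and wbN: "w = word_size A n" "b = base t c" "N = cells A n"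
    and xs: "dynamic_stream n xs"
  shows "rel_pmf (\<lambda>x f. x = Some (estimate n (stream_graph xs) t P (set (sampled cap n f)), 0))
    (run_alg A n xs) (sample n P)"
proof -
  have stack: "16 + stack_com (init_com t c) \<le> b" using wbN(2) by (simp add: base_def)
  have init: "init_prog A = compile b (init_com t c)" using A wbN(2) by (simp add: cc_alg_def)
  have "sim ((\<lambda>_. 0)(0 := n)) ((replicate N 0)[0 := n])"
    using b_ge b_le by (auto simp: sim_def in_mem_def nth_list_update)
  then have rel: "rel_pmf (\<lambda>x f. \<exists>m' \<sigma>. x = Some m' \<and> sim \<sigma> m' \<and> st {} (sampled cap n f) \<sigma> \<and>
      \<sigma> 0 = estimate n {} t P (set (sampled cap n f)))
      (run (word_size A n) (init_prog A) ((replicate (cells A n) 0)[0 := n])) (sample n P)"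
    using rwp_init_com stack unfolding rwp_def init wbN(1,3)[symmetric] by blast
  have "rel_pmf (\<lambda>x f. x = Some (estimate n (stream_graph xs) t P (set (sampled cap n f)), 0))
    (run_alg A n xs) (bind_pmf (sample n P) return_pmf)"
    unfolding run_alg_Skip[of A n xs, OF A[THEN arg_cong[of _ _ post_prog], unfolded cc_alg_def, simplified]]
  proof (rule rel_bind_spmf[OF rel])
    fix y f
    let ?L = "sampled cap n f"
    let ?R = "\<lambda>x f. x = Some (estimate n (stream_graph xs) t P (set (sampled cap n f)), 0)"
    assume "\<exists>m' \<sigma>. y = Some m' \<and> sim \<sigma> m' \<and> st {} ?L \<sigma> \<and> \<sigma> 0 = estimate n {} t P (set ?L)"
    then obtain m' \<sigma> where y: "y = Some m'" and \<sigma>: "sim \<sigma> m'" "st {} ?L \<sigma>"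
      "\<sigma> 0 = estimate n {} t P (set ?L)" by blast
    have sim0: "m ! 0 = \<tau> 0" if "sim \<tau> m" for \<tau> m using that in_mem_var[of 0] by (simp add: sim_def)
    have "rel_pmf ?R (bind_spmf (run_updates A n xs m') (\<lambda>m1. return_spmf (m1 ! 0, 0)))
        (bind_pmf (return_pmf ()) (\<lambda>_. return_pmf f))"
      by (rule rel_bind_spmf[OF run_updates_cc_alg[OF A wbN xs valid_sampled[OF order_refl] \<sigma>(2,1,3)]])
         (auto dest: sim0)
    then show "\<exists>m'. y = Some m' \<and>
        rel_pmf ?R (bind_spmf (run_updates A n xs m') (\<lambda>m1. return_spmf (m1 ! 0, 0))) (return_pmf f)"
      using y by (simp add: bind_return_pmf)
  qed
  then show ?thesis by (simp add: bind_return_pmf')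
qed

end

lemma post_time_cc_alg:
  assumes "1 \<le> t" "1 \<le> c" "1 \<le> n" "0 \<le> T"
  shows "post_time_le (cc_alg t c) n T"
  unfolding post_time_le_def
proof (intro allI impI)
  fix xs assume xs: "dynamic_stream n xs"
  interpret sampler "word_size (cc_alg t c) n" "base t c" "cells (cc_alg t c) n" t n "rate t c n" c
    "rate_exponent t c n" using assms by (intro sampler_cc_alg)
  have "\<exists>Y. x = Some (Y, 0)" if "x \<in> set_pmf (run_alg (cc_alg t c) n xs)" for x
    using rel_pmf_in_set[OF run_cc_alg[OF refl refl refl refl xs] that] by blast
  then show "lossless_spmf (run_alg (cc_alg t c) n xs) \<and>
      (\<forall>(Y, s)\<in>set_spmf (run_alg (cc_alg t c) n xs). real s \<le> T)"
    using assms by (fastforce simp: lossless_iff_set_pmf_None in_set_spmf)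
qed

lemma estimates_components_cc_alg:
  assumes t: "1 \<le> t" and c: "1 \<le> c" and "0 < \<delta>" "6 \<le> real c * \<delta>\<^sup>2" "\<delta> + 1 / (real t + 1) \<le> \<epsilon>"
  shows "estimates_components (cc_alg t c) (\<lambda>n. \<epsilon> * real n) (2 / 3)"
  unfolding estimates_components_def
proof (intro allI impI)
  fix n xs assume n: "1 \<le> n" and xs: "dynamic_stream n xs"
  interpret sampler "word_size (cc_alg t c) n" "base t c" "cells (cc_alg t c) n" t n "rate t c n" c
    "rate_exponent t c n" using t c n by (intro sampler_cc_alg)
  let ?p = "run_alg (cc_alg t c) n xs" and ?E = "stream_graph xs" and ?P = "rate t c n"
  let ?good = "{(Y, s). \<bar>real Y - real (num_components n ?E)\<bar> \<le> \<epsilon> * real n}"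
  let ?G = "{f. card {v \<in> {1..n}. f v} \<le> 6 * n div ?P \<and>
      \<bar>real (estimate n ?E t ?P {v \<in> {1..n}. f v}) - real (num_components n ?E)\<bar> \<le> \<epsilon> * real n}"
  let ?R = "\<lambda>x f. x = Some (estimate n ?E t ?P (set (sampled cap n f)), 0)"
  have "rate t c n = 1 \<or> real c * real ?P ^ t \<le> real n"
    using rate_cases[OF t c, of n] by (metis of_nat_le_iff of_nat_mult of_nat_power)
  then have "2 / 3 \<le> measure (sample n ?P) ?G"
    using n P_pos assms(3-5) by (intro sample_good[where c = "real c" and \<delta> = \<delta>]) auto
  also have "\<dots> \<le> measure ?p {x. \<exists>f\<in>?G. ?R\<inverse>\<inverse> f x}"
    by (rule rel_pmf_measureD[OF pmf.rel_flip[THEN iffD2, OF run_cc_alg[OF refl refl refl refl xs]]])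
  also have "\<dots> \<le> measure ?p (Some ` ?good)"
  proof (rule measure_pmf.finite_measure_mono)
    show "{x. \<exists>f\<in>?G. ?R\<inverse>\<inverse> f x} \<subseteq> Some ` ?good"
    proof
      fix x assume "x \<in> {x. \<exists>f\<in>?G. ?R\<inverse>\<inverse> f x}"
      then obtain f where f: "f \<in> ?G" "?R x f" by blast
      have set: "set (filter f [1..<Suc n]) = {v \<in> {1..n}. f v}" by auto
      have "length (filter f [1..<Suc n]) = card {v \<in> {1..n}. f v}"
        unfolding set[symmetric] by (rule distinct_card[symmetric]) simp
      \<comment> \<open>On the good event the sample fits into memory and the cut is
        inactive.\<close>
      then have "sampled cap n f = filter f [1..<Suc n]"
        using f(1) by (simp add: sampled_def cap_def)
      with set f show "x \<in> Some ` ?good" by auto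
    qed
  qed simp
  also have "\<dots> = measure (measure_spmf ?p) ?good"
    by (simp add: measure_measure_spmf_conv_measure_pmf)
  finally show "2 / 3 \<le> measure (measure_spmf ?p) ?good" .
qed

section \<open>The bound \<open>n powr (1 - \<epsilon>) * ln n\<close>\<close>

subsection \<open>Space\<close>

lemma floorlog_le_ln:
  assumes "2 \<le> n"
  shows "real (floorlog 2 n) \<le> 2 / ln 2 * ln (real n)"
proof -
  have "real (floorlog 2 n) = real_of_int (\<lfloor>log 2 (real n)\<rfloor> + 1)"
    using assms by (simp add: floorlog_def)
  also have "\<dots> \<le> log 2 (real n) + 1" by simp
  also have "\<dots> \<le> log 2 (real n) + log 2 (real n)" using assms by simp
  also have "\<dots> = 2 / ln 2 * ln (real n)" by (simp add: log_def field_simps)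
  finally show ?thesis .
qed

text \<open>That the next doubling fails, \<open>n < c * (2 * P) ^ t\<close>, gives
  \<open>n powr (1 / t) \<le> 2 * c * P\<close> and so
  \<open>n / P \<le> 2 * c * n powr (1 - \<epsilon>)\<close>; the cap contributes the other factor
  \<open>6\<close> of \<open>12\<close>.\<close>

lemma cells_cc_alg:
  assumes t: "1 \<le> t" and c: "1 \<le> c" and n: "1 \<le> n" and \<epsilon>: "\<epsilon> \<le> 1 / real t"
  shows "real (cells (cc_alg t c) n) \<le>
    real (base t c + 12 * c * (2 * t + 3)) * real n powr (1 - \<epsilon>)"
proof -
  let ?P = "rate t c n"
  have P: "1 \<le> ?P" by (simp add: rate_def)
  have "real n < real c * (2 * real ?P) ^ t"
    using rate_exponent(1)[OF t c, of n] unfolding rate_def[symmetric]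
    by (metis of_nat_less_iff of_nat_mult of_nat_numeral of_nat_power)
  \<comment> \<open>Weakening \<open>c\<close> to \<open>c ^ t\<close> makes the right side a
    perfect power.\<close>
  also have "\<dots> \<le> real c ^ t * (2 * real ?P) ^ t"
    using t c self_le_power[of "real c" t] by (intro mult_right_mono) auto
  also have "\<dots> = (2 * real c * real ?P) powr real t"
    using P c by (simp add: powr_realpow power_mult_distrib)
  finally have "real n powr (1 / real t) \<le> ((2 * real c * real ?P) powr real t) powr (1 / real t)"
    by (intro powr_mono2) auto
  also have "\<dots> = 2 * real c * real ?P" using t P c by (simp add: powr_powr)
  finally have root: "real n powr (1 / real t) \<le> 2 * real c * real ?P" .
  have "real n powr \<epsilon> \<le> real n powr (1 / real t)" using n \<epsilon> by (intro powr_mono) auto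
  with root have "real n powr \<epsilon> \<le> 2 * real c * real ?P" by linarith
  then have "real n powr \<epsilon> * real n powr (1 - \<epsilon>) \<le> 2 * real c * real ?P * real n powr (1 - \<epsilon>)"
    by (rule mult_right_mono) simp
  then have n_le: "real n \<le> 2 * real c * real ?P * real n powr (1 - \<epsilon>)"
    using n by (simp flip: powr_add)
  have "real (6 * n div ?P) \<le> real (6 * n) / real ?P" by (rule of_nat_div_le_of_nat)
  also have "\<dots> \<le> 12 * real c * real n powr (1 - \<epsilon>)"
    using n_le P by (simp add: field_simps)
  finally have cap: "real (6 * n div ?P) \<le> 12 * real c * real n powr (1 - \<epsilon>)" .
  have "\<epsilon> \<le> 1" using \<epsilon> t by (simp add: order_trans[of _ "1 / real t"])
  then have "1 \<le> real n powr (1 - \<epsilon>)" using n by (intro ge_one_powr_ge_zero) auto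
  then have base: "real (base t c) * 1 \<le> real (base t c) * real n powr (1 - \<epsilon>)"
    by (rule mult_left_mono) simp
  have "real (6 * n div ?P) * real (2 * t + 3) \<le> 12 * real c * real n powr (1 - \<epsilon>) * real (2 * t + 3)"
    using cap by (rule mult_right_mono) simp
  with base show ?thesis by (simp add: cc_alg_def algebra_simps)
qed

lemma space_cc_alg:
  assumes "1 \<le> t" "1 \<le> c" "2 \<le> n" "\<epsilon> \<le> 1 / real t"
  shows "real (space_bits (cc_alg t c) n) \<le>
    real (base t c + 12 * c * (2 * t + 3)) * real (factor t c) * (2 / ln 2) *
      real n powr (1 - \<epsilon>) * ln (real n)"
proof -
  have "real (space_bits (cc_alg t c) n) =
      real (cells (cc_alg t c) n) * (real (factor t c) * real (floorlog 2 n))"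
    by (simp add: space_bits_def word_size_def cc_alg_def)
  also have "\<dots> \<le> (real (base t c + 12 * c * (2 * t + 3)) * real n powr (1 - \<epsilon>)) *
      (real (factor t c) * (2 / ln 2 * ln (real n)))"
    using assms by (intro mult_mono cells_cc_alg mult_left_mono floorlog_le_ln) auto
  finally show ?thesis by (simp only: mult_ac)
qed

section \<open>The case \<open>\<epsilon> \<ge> 1\<close>\<close>

section \<open>The trivial algorithm\<close>

definition trivial_alg :: streaming_alg where
  "trivial_alg = \<lparr>word_factor = 1, cells = (\<lambda>_. 3), init_prog = Skip, update_prog = Skip,
     post_prog = Skip\<rparr>"

lemma trivial_alg_simps [simp]:
  "word_factor trivial_alg = 1" "cells trivial_alg n = 3" "init_prog trivial_alg = Skip"
  "update_prog trivial_alg = Skip" "post_prog trivial_alg = Skip"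
  by (simp_all add: trivial_alg_def)

lemma run_updates_trivial:
  "run_updates trivial_alg n xs m = return_spmf (fold feed xs m)"
  by (induction xs rule: rev_induct) (simp_all add: run_updates_snoc run_Skip)

lemma run_trivial:
  assumes "1 \<le> n"
  shows "\<exists>Y\<le>n. run_alg trivial_alg n xs = return_spmf (Y, 0)"
proof -
  let ?m = "(replicate 3 0)[0 := n]"
  \<comment> \<open>Cell \<open>0\<close> holds \<open>n\<close>, or the flag \<open>0\<close> or
    \<open>1\<close> left by the last update; with \<open>1 \<le> n\<close> each is at most
    \<open>n\<close>.\<close>
  have "length (fold feed xs ?m) = 3 \<and> fold feed xs ?m ! 0 \<le> n"
  proof (induction xs rule: rev_induct)
    case (snoc x xs)
    then show ?case using assms by (cases x) (auto simp: nth_list_update)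
  qed simp
  moreover have "run_alg trivial_alg n xs = return_spmf (fold feed xs ?m ! 0, 0)"
    by (simp add: run_alg_Skip run_Skip run_updates_trivial)
  ultimately show ?thesis by blast
qed

lemma estimates_components_trivial:
  assumes "1 \<le> \<epsilon>"
  shows "estimates_components trivial_alg (\<lambda>n. \<epsilon> * real n) (2 / 3)"
  unfolding estimates_components_def
proof (intro allI impI)
  fix n :: nat and xs assume n: "1 \<le> n"
  obtain Y where Y: "Y \<le> n" "run_alg trivial_alg n xs = return_spmf (Y, 0)"
    using run_trivial[OF n] by blast
  have "num_components n (stream_graph xs) \<le> n" by (simp add: num_components_eq card_components_le)
  then have "\<bar>real Y - real (num_components n (stream_graph xs))\<bar> \<le> 1 * real n" using Y(1) by simp
  also have "\<dots> \<le> \<epsilon> * real n" using assms by (intro mult_right_mono) auto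
  finally show "2 / 3 \<le> measure (measure_spmf (run_alg trivial_alg n xs))
      {(Y, t). \<bar>real Y - real (num_components n (stream_graph xs))\<bar> \<le> \<epsilon> * real n}"
    by (simp add: Y(2) measure_measure_spmf_conv_measure_pmf)
qed

lemma post_time_trivial: "1 \<le> n \<Longrightarrow> 0 \<le> T \<Longrightarrow> post_time_le trivial_alg n T"
  unfolding post_time_le_def
proof (intro allI impI)
  fix xs assume "1 \<le> n" "0 \<le> T"
  with run_trivial[of n xs] obtain Y where "run_alg trivial_alg n xs = return_spmf (Y, 0)" by blast
  with \<open>0 \<le> T\<close> show "lossless_spmf (run_alg trivial_alg n xs) \<and>
      (\<forall>(Y, t)\<in>set_spmf (run_alg trivial_alg n xs). real t \<le> T)" by simp
qed

theorem theorem3p2: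
  fixes \<epsilon> :: real
  assumes "\<epsilon> > 0"
  shows "\<exists>C>0. \<exists>k::nat. \<forall>q::real. q \<ge> 1 \<longrightarrow>
    (\<exists>A. wf_alg A \<and>
         estimates_components A (\<lambda>n. \<epsilon> * real n) (2 / 3) \<and>
         (\<forall>n\<ge>2.
            let B = C * exp (q + 1) * real n powr (1 - \<epsilon> + \<epsilon> powr (q + 1)) * ln (real n) ^ k
            in real (space_bits A n) \<le> B \<and> post_time_le A n B))"
proof (cases "\<epsilon> < 1")
  case True
  define t where "t = nat \<lfloor>1 / \<epsilon>\<rfloor>"
  have "1 \<le> 1 / \<epsilon>" using True assms by simp
  then have fl: "1 \<le> \<lfloor>1 / \<epsilon>\<rfloor>" by (simp add: le_floor_iff)
  then have t: "1 \<le> t" unfolding t_def by linarith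
  have t_eq: "real t = of_int \<lfloor>1 / \<epsilon>\<rfloor>" unfolding t_def using fl by (intro of_nat_nat) linarith
  have "real t \<le> 1 / \<epsilon>" "1 / \<epsilon> < real t + 1" unfolding t_eq by linarith+
  then have \<epsilon>: "\<epsilon> \<le> 1 / real t" "1 / (real t + 1) < \<epsilon>" using assms t by (simp_all add: field_simps)
  define \<delta> where "\<delta> = \<epsilon> - 1 / (real t + 1)"
  have \<delta>: "0 < \<delta>" "\<delta> + 1 / (real t + 1) \<le> \<epsilon>" using \<epsilon> by (auto simp: \<delta>_def)
  \<comment> \<open>Large enough for Chebyshev's inequality to leave a failure probability of at
    most \<open>1 / 6\<close>, and dependent on \<open>\<epsilon>\<close> only.\<close>
  define c where "c = nat \<lceil>6 / \<delta>\<^sup>2\<rceil> + 1"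
  have c: "1 \<le> c" by (simp add: c_def)
  have "6 / \<delta>\<^sup>2 \<le> real c" unfolding c_def by linarith
  then have c\<delta>: "6 \<le> real c * \<delta>\<^sup>2" using \<delta> by (simp add: field_simps)
  define C where "C = real (base t c + 12 * c * (2 * t + 3)) * real (factor t c) * (2 / ln 2)"
  have "0 < real (base t c + 12 * c * (2 * t + 3))" "0 < real (factor t c)" "0 < 2 / ln (2::real)"
    unfolding of_nat_0_less_iff by (simp_all add: base_def factor_def)
  then have C: "0 < C" unfolding C_def by (intro mult_pos_pos)
  have wf: "wf_alg (cc_alg t c)" by (simp add: wf_alg_def cc_alg_def factor_def base_def)
  have bound: "real (space_bits (cc_alg t c) n) \<le>
        C * exp (q + 1) * real n powr (1 - \<epsilon> + \<epsilon> powr (q + 1)) * ln (real n) ^ 1 \<and>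
      post_time_le (cc_alg t c) n
        (C * exp (q + 1) * real n powr (1 - \<epsilon> + \<epsilon> powr (q + 1)) * ln (real n) ^ 1)"
    if q: "1 \<le> q" and n: "2 \<le> n" for q n
  proof
    have ln: "0 \<le> ln (real n)" using n by simp
    \<comment> \<open>\<open>exp (q + 1)\<close> is at least \<open>1\<close> and
      \<open>\<epsilon> powr (q + 1)\<close> is nonnegative, so a constant chosen before
      \<open>q\<close> suffices.\<close>
    have "C * 1 * real n powr (1 - \<epsilon>) \<le> C * exp (q + 1) * real n powr (1 - \<epsilon> + \<epsilon> powr (q + 1))"
      using C q n by (intro mult_mono powr_mono) auto
    then have "C * real n powr (1 - \<epsilon>) * ln (real n) \<le>
        C * exp (q + 1) * real n powr (1 - \<epsilon> + \<epsilon> powr (q + 1)) * ln (real n)"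
      using ln by (intro mult_right_mono) auto
    then show "real (space_bits (cc_alg t c) n) \<le>
        C * exp (q + 1) * real n powr (1 - \<epsilon> + \<epsilon> powr (q + 1)) * ln (real n) ^ 1"
      using space_cc_alg[OF t c n \<epsilon>(1)] unfolding C_def by simp
    show "post_time_le (cc_alg t c) n
        (C * exp (q + 1) * real n powr (1 - \<epsilon> + \<epsilon> powr (q + 1)) * ln (real n) ^ 1)"
      using C ln n t c by (intro post_time_cc_alg) auto
  qed
  show ?thesis
    unfolding Let_def
    using C wf estimates_components_cc_alg[OF t c \<delta>(1) c\<delta> \<delta>(2)] bound
    by (intro exI[of _ C] conjI exI[of _ 1] allI impI exI[of _ "cc_alg t c"]) blast+
next
  case False
  then have \<epsilon>: "1 \<le> \<epsilon>" by simp
  \<comment> \<open>Three cells times the factor \<open>2 / ln 2\<close> from bounding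
    \<open>floorlog\<close> by \<open>ln\<close>.\<close>
  define C :: real where "C = 6 / ln 2"
  have C: "0 < C" by (simp add: C_def)
  have bound: "real (space_bits trivial_alg n) \<le>
        C * exp (q + 1) * real n powr (1 - \<epsilon> + \<epsilon> powr (q + 1)) * ln (real n) ^ 1 \<and>
      post_time_le trivial_alg n
        (C * exp (q + 1) * real n powr (1 - \<epsilon> + \<epsilon> powr (q + 1)) * ln (real n) ^ 1)"
    if q: "1 \<le> q" and n: "2 \<le> n" for q n
  proof
    have ln: "0 \<le> ln (real n)" using n by simp
    \<comment> \<open>For \<open>\<epsilon> \<ge> 1\<close> the term
      \<open>\<epsilon> powr (q + 1)\<close> outweighs \<open>- \<epsilon>\<close>, so the exponent
      of \<open>n\<close> is nonnegative and the bound covers logarithmic space.\<close>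
    have "\<epsilon> powr 1 \<le> \<epsilon> powr (q + 1)" using \<epsilon> q by (intro powr_mono) auto
    then have "0 \<le> 1 - \<epsilon> + \<epsilon> powr (q + 1)" using \<epsilon> by simp
    then have "1 \<le> real n powr (1 - \<epsilon> + \<epsilon> powr (q + 1))" using n by (intro ge_one_powr_ge_zero) auto
    then have "C * 1 * 1 \<le> C * exp (q + 1) * real n powr (1 - \<epsilon> + \<epsilon> powr (q + 1))"
      using C q by (intro mult_mono) auto
    then have "C * ln (real n) \<le>
        C * exp (q + 1) * real n powr (1 - \<epsilon> + \<epsilon> powr (q + 1)) * ln (real n)"
      using ln by (intro mult_right_mono) auto
    moreover have "real (space_bits trivial_alg n) \<le> C * ln (real n)"
      using floorlog_le_ln[OF n] by (simp add: space_bits_def word_size_def C_def)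
    ultimately show "real (space_bits trivial_alg n) \<le>
        C * exp (q + 1) * real n powr (1 - \<epsilon> + \<epsilon> powr (q + 1)) * ln (real n) ^ 1" by simp
    show "post_time_le trivial_alg n
        (C * exp (q + 1) * real n powr (1 - \<epsilon> + \<epsilon> powr (q + 1)) * ln (real n) ^ 1)"
      using C ln n by (intro post_time_trivial) auto
  qed
  have wf: "wf_alg trivial_alg" by (simp add: wf_alg_def)
  show ?thesis
    unfolding Let_def
    using C wf estimates_components_trivial[OF \<epsilon>] bound
    by (intro exI[of _ C] conjI exI[of _ 1] allI impI exI[of _ trivial_alg]) blast+
qed

end
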